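(* Let $f\in\mathcal{B}$ be a transcendental entire function, let $r_0>0$ be such that all singular values of $f$ lie in $D(0,r_0)$, put $\theta(r)=\operatorname{meas}\{t\in[0,2\pi]: |f(re^{it})|<r_0\}$, and let $r'>0$. Let $A:[r',\infty)\to\mathbb{R}$ be continuous and increasing with $A(r)<\log r$ for large $r$ and $$\sum_{k=1}^{\infty}\frac{1}{A\left(E^k(0)\right)}=\infty.$$ Suppose that for $r\geq r'$ $$\log\log M(r,f)\leq A(r)\log r\qquad\text{and}\qquad \frac{1}{\log r}\int_{r^c}^{r}\theta(t)\frac{dt}{t}\geq\frac{1}{A(r)},$$ where $c$ is a constant with $63/65\leq c<1$. Then the escaping set $\mathcal{I}(f)$ has Lebesgue measure zero.
   Context: $\operatorname{meas}$ is one-dimensional Lebesgue measure; $E(x)=e^x$, $E^k$ its $k$-th iterate; $M(r,f)=\max_{|z|=r}|f(z)|$. $\mathcal{B}$ is the class of transcendental entire functions whose set of singular values (closure in $\mathbb{C}$ of the critical and asymptotic values) is bounded. $\mathcal{I}(f)=\{z: f^n(z)\to\infty\}$. *)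

theory Defs
  imports "HOL-Analysis.Analysis" "HOL-Computational_Algebra.Polynomial"
begin

definition transcendental_entire :: "(complex \<Rightarrow> complex) \<Rightarrow> bool" where
  "transcendental_entire f \<longleftrightarrow> f holomorphic_on UNIV \<and> \<not> (\<exists>p :: complex poly. \<forall>z. f z = poly p z)"

definition critical_values :: "(complex \<Rightarrow> complex) \<Rightarrow> complex set" where
  "critical_values f = {f z | z. deriv f z = 0}"

definition asymptotic_values :: "(complex \<Rightarrow> complex) \<Rightarrow> complex set" where
  "asymptotic_values f = {a. \<exists>\<gamma> :: real \<Rightarrow> complex. continuous_on {0..} \<gamma> \<and>
      filterlim \<gamma> at_infinity at_top \<and> ((\<lambda>t. f (\<gamma> t)) \<longlongrightarrow> a) at_top}"

definition singular_values :: "(complex \<Rightarrow> complex) \<Rightarrow> complex set" where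
  "singular_values f = closure (critical_values f \<union> asymptotic_values f)"

definition class_B :: "(complex \<Rightarrow> complex) \<Rightarrow> bool" where
  "class_B f \<longleftrightarrow> transcendental_entire f \<and> bounded (singular_values f)"

definition max_modulus :: "(complex \<Rightarrow> complex) \<Rightarrow> real \<Rightarrow> real" where
  "max_modulus f r = (SUP z\<in>sphere 0 r. norm (f z))"

definition theta :: "(complex \<Rightarrow> complex) \<Rightarrow> real \<Rightarrow> real \<Rightarrow> real" where
  "theta f r0 r = measure lborel {t \<in> {0..2*pi}. norm (f (of_real r * exp (\<i> * of_real t))) < r0}"

definition escaping_set :: "(complex \<Rightarrow> complex) \<Rightarrow> complex set" where
  "escaping_set f = {z. filterlim (\<lambda>n. (f ^^ n) z) at_infinity sequentially}"

definition Eit :: "nat \<Rightarrow> real" where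
  "Eit k = (exp ^^ k) 0"

end

theory Submission
  imports Defs "HOL-Complex_Analysis.Complex_Analysis" "HOL-Real_Asymp.Real_Asymp"
begin

text \<open>
  In logarithmic coordinates \<open>z = exp w\<close> the map \<open>f\<close> has, outside a large disc, univalent inverse
  branches on a half-plane. Since the exponential is injective on their images, they contract by a
  factor \<open>O(1 / Re w)\<close>. Hence, if the orbit of \<open>exp w\<close> stays large for \<open>n\<close> steps and the \<open>n\<close>-th
  iterate is \<open>exp v\<close>, then the disc of radius \<open>Re v / 2\<close> about \<open>v\<close> is pulled back univalently into
  a disc of bounded size about \<open>w\<close>, and on the disc of half that radius with bounded distortion.
  The condition on \<open>\<theta>\<close> says that the points which \<open>f \<circ> exp\<close> maps into the disc of radius \<open>r\<^sub>0\<close>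
  fill a proportion of order \<open>1 / A\<close> of the disc about \<open>v\<close>. By the growth condition
  \<open>Re v \<le> E\<^sup>n\<^sup>+\<^sup>k(0)\<close> with \<open>k\<close> depending only on the size of \<open>w\<close>. So the
  set \<open>B\<^sub>n\<close> of points that first enter the small disc at step \<open>n + 1\<close> fills, near every point of a
  bounded set \<open>E\<close> of points whose orbits stay large, a proportion at least of order
  \<open>1 / A(E\<^sup>n\<^sup>+\<^sup>k\<^sup>+\<^sup>1(0))\<close>. As the \<open>B\<^sub>n\<close> are disjoint and these proportions have
  infinite sum, Vitali's covering lemma forces \<open>E\<close> to be a null set.
\<close>

subsection \<open>Lifts of the exponential\<close>

text \<open>The size of a pulled-back disc varies with the point and with \<open>n\<close>; only
  ratios of areas are controlled. So every point of \<open>E\<close> brings its own radius, and the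
  local estimates are added up by a covering lemma valid for arbitrary radii. The constants need
  only be universal: distortion is bounded crudely, through an omitted value and the theorems of
  Bloch and Schottky, and area through disjoint discs. The shift by \<open>k\<close> must serve all
  points of \<open>E\<close> at once, whence \<open>E\<close> is bounded; it removes finitely many
  terms of the series, which leaves divergence intact. The comparison with iterated exponentials
  rests on \<open>A(r) < log r\<close>: with the growth condition it gives
  \<open>x' \<le> exp (x^2)\<close> for the logarithms \<open>x\<close>, \<open>x'\<close> of
  consecutive moduli. The two kinds of singular values enter separately: without critical values
  there are local inverses, without asymptotic values a continued lift cannot run off to
  infinity.\<close>

lemma holomorphic_local_inverse:
  assumes "f holomorphic_on UNIV" and "deriv f p \<noteq> 0"
  obtains N h where "open N" "p \<in> N" "inj_on f N" "open (f ` N)" "h holomorphic_on f ` N"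
    "\<And>z. z \<in> N \<Longrightarrow> h (f z) = z"
proof -
  obtain r where r: "r > 0" "inj_on f (ball p r)"
    using has_complex_derivative_locally_injective[OF assms(1), of p] assms(2) by auto
  have hol: "f holomorphic_on ball p r"
    using assms(1) holomorphic_on_subset by blast
  obtain h where "h holomorphic_on f ` ball p r" "\<And>z. z \<in> ball p r \<Longrightarrow> h (f z) = z"
    using holomorphic_has_inverse[OF hol _ r(2)] by (metis open_ball)
  moreover have "open (f ` ball p r)"
    using open_mapping_thm3[OF hol _ r(2)] by simp
  ultimately show ?thesis
    using that[of "ball p r" h] r by simp
qed

text \<open>A branch of \<open>f^-1 o exp\<close> on \<open>S\<close>. Composing with
  \<open>exp\<close> moves the problem from the exterior of a disc, which is not simply connected,
  to a half-plane, where branches are single-valued.\<close>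

definition exp_lift :: "(complex \<Rightarrow> complex) \<Rightarrow> (complex \<Rightarrow> complex) \<Rightarrow> complex set \<Rightarrow> bool" where
  "exp_lift f g S \<longleftrightarrow> g holomorphic_on S \<and> (\<forall>w\<in>S. f (g w) = exp w)"

lemma exp_lift_subset: "exp_lift f g S \<Longrightarrow> T \<subseteq> S \<Longrightarrow> exp_lift f g T"
  unfolding exp_lift_def using holomorphic_on_subset by blast

lemma exp_lift_local:
  assumes "f holomorphic_on UNIV" and "deriv f p \<noteq> 0" and fp: "f p = exp \<zeta>"
  obtains e h N where "e > 0" "open N" "p \<in> N" "inj_on f N" "exp_lift f h (ball \<zeta> e)"
    "h \<zeta> = p" "h ` ball \<zeta> e \<subseteq> N"
proof -
  obtain N h where N: "open N" "p \<in> N" "inj_on f N" "open (f ` N)" "h holomorphic_on f ` N"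
    and h: "\<And>z. z \<in> N \<Longrightarrow> h (f z) = z"
    using holomorphic_local_inverse[OF assms(1,2)] by metis
  have "open (exp -` (f ` N) :: complex set)"
    using N(4) by (simp add: continuous_open_vimage continuous_on_exp)
  moreover have "\<zeta> \<in> exp -` (f ` N)"
    using N(2) fp by (metis imageI vimageI)
  ultimately obtain e where e: "e > 0" "ball \<zeta> e \<subseteq> exp -` (f ` N)"
    using openE by blast
  have "(\<lambda>w. h (exp w)) holomorphic_on ball \<zeta> e"
  proof -
    have "(h \<circ> exp) holomorphic_on ball \<zeta> e"
      using e(2) by (intro holomorphic_on_compose_gen[OF _ N(5)] holomorphic_intros) auto
    then show ?thesis by (simp add: o_def)
  qed
  moreover have "f (h (exp w)) = exp w \<and> h (exp w) \<in> N" if "w \<in> ball \<zeta> e" for w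
  proof -
    have "exp w \<in> f ` N" using that e(2) by auto
    then obtain z where "z \<in> N" "exp w = f z" by blast
    then show ?thesis using h by simp
  qed
  moreover have "h (exp \<zeta>) = p"
    using fp h N(2) by metis
  ultimately show ?thesis
    using e N by (intro that[of e N "\<lambda>w. h (exp w)"]) (auto simp: exp_lift_def)
qed

locale no_singular_values_outside =
  fixes f :: "complex \<Rightarrow> complex" and R :: real
  assumes holf: "f holomorphic_on UNIV"
    and R_pos: "R > 0"
    and noncritical: "\<And>z. R < norm (f z) \<Longrightarrow> deriv f z \<noteq> 0"
    and asymptotic: "\<And>\<gamma> a. continuous_on {0..} \<gamma> \<Longrightarrow> filterlim \<gamma> at_infinity at_top \<Longrightarrow>
        ((\<lambda>t::real. f (\<gamma> t)) \<longlongrightarrow> a) at_top \<Longrightarrow> norm a \<le> R"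
begin

definition H :: "complex set" where "H = {w. ln R < Re w}"

lemma open_H: "open H" and convex_H: "convex H"
  unfolding H_def by (auto simp: open_halfspace_Re_gt convex_halfspace_Re_gt)

lemma norm_exp_H: "w \<in> H \<Longrightarrow> R < norm (exp w)"
  using R_pos by (simp add: H_def) (metis exp_less_mono exp_ln)

lemma ball_subset_H: "r \<le> Re w - ln R \<Longrightarrow> ball w r \<subseteq> H"
proof
  fix u assume "r \<le> Re w - ln R" "u \<in> ball w r"
  moreover have "Re w - Re u \<le> norm (w - u)"
    using complex_Re_le_cmod[of "w - u"] by simp
  ultimately show "u \<in> H" by (simp add: H_def dist_norm)
qed

lemma deriv_lift_ne_0: "exp_lift f g S \<Longrightarrow> w \<in> S \<Longrightarrow> w \<in> H \<Longrightarrow> deriv f (g w) \<noteq> 0"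
  using noncritical norm_exp_H by (metis exp_lift_def)

text \<open>Near \<open>p\<close> both lifts take values in a neighbourhood \<open>N\<close> of the
  common value on which \<open>f\<close> is injective, and they have the same image under
  \<open>f\<close>; so they coincide there, and the identity theorem does the rest.\<close>

lemma exp_lift_unique:
  assumes C: "open C" "connected C" "C \<subseteq> H" and g: "exp_lift f g C" and h: "exp_lift f h C"
    and p: "p \<in> C" "g p = h p" and w: "w \<in> C"
  shows "g w = h w"
proof -
  obtain N where N: "open N" "g p \<in> N" "inj_on f N"
    using holomorphic_local_inverse[OF holf deriv_lift_ne_0[OF g p(1)]] p C(3) by (metis subsetD)
  have cont: "continuous_on C g" "continuous_on C h"
    using g h holomorphic_on_imp_continuous_on by (auto simp: exp_lift_def)
  define U where "U = (C \<inter> g -` N) \<inter> (C \<inter> h -` N)"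
  have "open U"
    unfolding U_def using cont C(1) N(1) by (intro open_Int continuous_open_preimage) auto
  moreover have "p \<in> U" using p N by (auto simp: U_def)
  moreover have "g z = h z" if "z \<in> U" for z
  proof -
    have "f (g z) = f (h z)" "g z \<in> N" "h z \<in> N"
      using that g h by (auto simp: U_def exp_lift_def)
    then show ?thesis using N(3) by (auto dest: inj_onD)
  qed
  ultimately show ?thesis
    using analytic_continuation_open[of U C g h w] C w g h by (auto simp: exp_lift_def U_def)
qed

text \<open>Convex sets through \<open>p\<close> meet in connected sets, so uniqueness makes the
  lifts agree on overlaps and they glue.\<close>

lemma exp_lift_Union:
  assumes U: "\<And>U. U \<in> \<U> \<Longrightarrow> open U \<and> convex U \<and> p \<in> U \<and> U \<subseteq> H \<and> (\<exists>g. exp_lift f g U \<and> g p = q)"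
    and ne: "\<U> \<noteq> {}"
  shows "\<exists>g. exp_lift f g (\<Union>\<U>) \<and> g p = q"
proof -
  obtain G where G: "\<And>U. U \<in> \<U> \<Longrightarrow> exp_lift f (G U) U \<and> G U p = q"
    using U by metis
  define g where "g w = G (SOME U. U \<in> \<U> \<and> w \<in> U) w" for w
  have g: "g w = G U w" if "U \<in> \<U>" "w \<in> U" for U w
  proof -
    define V where "V = (SOME U. U \<in> \<U> \<and> w \<in> U)"
    have V: "V \<in> \<U> \<and> w \<in> V"
      unfolding V_def by (rule someI[of _ U]) (use that in auto)
    have "G V w = G U w"
    proof (rule exp_lift_unique[of "V \<inter> U" "G V" "G U" p])
      show "connected (V \<inter> U)"
        using U V that by (simp add: convex_Int convex_connected)
      show "G V p = G U p" using G V that by simp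
    qed (use U V that G in \<open>auto intro: exp_lift_subset\<close>)
    then show ?thesis by (simp add: g_def V_def)
  qed
  have "g holomorphic_on U" if "U \<in> \<U>" for U
    using G[OF that] g[OF that] by (metis exp_lift_def holomorphic_cong)
  then have "g holomorphic_on \<Union>\<U>"
    using holomorphic_on_UN_open[of \<U> g "\<lambda>U. U"] U by simp
  moreover have "f (g w) = exp w" if "w \<in> \<Union>\<U>" for w
    using that G g by (auto simp: exp_lift_def)
  moreover have "g p = q" using ne U G g by (metis ex_in_conv)
  ultimately show ?thesis by (auto simp: exp_lift_def)
qed

text \<open>A lift along a radius that runs off to infinity would exhibit an asymptotic value outside
  the disc of radius \<open>R\<close>; hence it accumulates at a finite point, where a local inverse of \<open>f\<close>
  continues the lift.\<close>

lemma exp_lift_boundary: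
  assumes r: "0 < r" "r < Re w0 - ln R" and g: "exp_lift f g (ball w0 r)" and u: "u \<in> cball w0 r"
  shows "\<exists>e>0. \<exists>h. ball u e \<subseteq> H \<and> exp_lift f h (ball u e) \<and> (\<forall>w\<in>ball u e \<inter> ball w0 r. h w = g w)"
proof (cases "u \<in> ball w0 r")
  case True
  then obtain e where "e > 0" "ball u e \<subseteq> ball w0 r"
    using open_ball openE by blast
  moreover have "ball w0 r \<subseteq> H" using r by (intro ball_subset_H) auto
  ultimately show ?thesis using g exp_lift_subset by blast
next
  case False
  then have ur: "dist w0 u = r" using u by auto
  have uH: "u \<in> H" using ball_subset_H[of "Re w0 - ln R" w0] r ur by auto
  \<comment> \<open>The radius from \<open>w0\<close> to \<open>u\<close> is run through in infinite
    time, the form in which \<open>asymptotic\<close> expects a path.\<close>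
  define \<tau> where "\<tau> t = w0 + of_real (t / (1 + t)) * (u - w0)" for t :: real
  have \<tau>_ball: "\<tau> t \<in> ball w0 r" if "t \<ge> 0" for t
  proof -
    have "dist w0 (\<tau> t) = (t / (1 + t)) * r"
      using that ur by (simp add: \<tau>_def dist_norm norm_mult norm_minus_commute del: of_real_divide)
    also have "\<dots> < 1 * r" using that r by (intro mult_strict_right_mono) auto
    finally show ?thesis by simp
  qed
  have "((\<lambda>t::real. t / (1 + t)) \<longlongrightarrow> 1) at_top" by real_asymp
  then have "(\<tau> \<longlongrightarrow> w0 + of_real 1 * (u - w0)) at_top"
    unfolding \<tau>_def by (intro tendsto_intros)
  then have \<tau>_lim: "(\<tau> \<longlongrightarrow> u) at_top" by simp
  have contg: "continuous_on (ball w0 r) g"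
    using g holomorphic_on_imp_continuous_on by (auto simp: exp_lift_def)
  have \<tau>_cont: "continuous_on {0..} \<tau>"
    unfolding \<tau>_def by (intro continuous_intros) auto
  define \<gamma> where "\<gamma> t = g (\<tau> t)" for t
  have "continuous_on {0..} (g \<circ> \<tau>)"
    by (rule continuous_on_compose[OF \<tau>_cont continuous_on_subset[OF contg]]) (use \<tau>_ball in auto)
  then have \<gamma>_cont: "continuous_on {0..} \<gamma>" by (simp add: o_def \<gamma>_def[abs_def])
  have f\<gamma>: "f (\<gamma> t) = exp (\<tau> t)" if "t \<ge> 0" for t
    using g \<tau>_ball[OF that] by (simp add: exp_lift_def \<gamma>_def)
  have lim: "((\<lambda>t. f (\<gamma> t)) \<longlongrightarrow> exp u) at_top"
  proof (rule Lim_transform_eventually)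
    show "((\<lambda>t. exp (\<tau> t)) \<longlongrightarrow> exp u) at_top" by (intro tendsto_intros \<tau>_lim)
    show "\<forall>\<^sub>F t in at_top. exp (\<tau> t) = f (\<gamma> t)"
      using eventually_ge_at_top[of 0] by eventually_elim (simp add: f\<gamma>)
  qed
  \<comment> \<open>The limit \<open>exp u\<close> has modulus above \<open>R\<close>, so it is not
    an asymptotic value.\<close>
  have "\<not> filterlim \<gamma> at_infinity at_top"
    using asymptotic[OF \<gamma>_cont _ lim] norm_exp_H[OF uH] by auto
  then obtain B where B: "\<not> eventually (\<lambda>t. B \<le> norm (\<gamma> t)) at_top"
    using filterlim_at_infinity[of 0 \<gamma> at_top] by auto
  then have "\<forall>n::nat. \<exists>t\<ge>real n. norm (\<gamma> t) < B"
    unfolding eventually_at_top_linorder by (metis not_le)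
  then obtain t where t: "\<And>n::nat. t n \<ge> real n" "\<And>n. norm (\<gamma> (t n)) < B"
    by metis
  have "compact (cball (0::complex) B)" by simp
  moreover have "\<forall>n. \<gamma> (t n) \<in> cball 0 B" using t(2) by (simp add: less_imp_le)
  ultimately obtain p s where s: "strict_mono s" "((\<lambda>n. \<gamma> (t n)) \<circ> s) \<longlonglongrightarrow> p"
    unfolding compact_def by meson
  define t' where "t' n = t (s n)" for n
  have t'0: "t' n \<ge> 0" for n
    using t(1)[of "s n"] by (simp add: t'_def)
  have "filterlim t' at_top sequentially"
  proof (rule filterlim_at_top_mono[OF filterlim_real_sequentially])
    show "\<forall>\<^sub>F n in sequentially. real n \<le> t' n"
      using t(1) seq_suble[OF s(1)] by (intro always_eventually) (metis t'_def of_nat_le_iff order_trans)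
  qed
  then have t'_lim: "(\<lambda>n. \<tau> (t' n)) \<longlonglongrightarrow> u" "(\<lambda>n. f (\<gamma> (t' n))) \<longlonglongrightarrow> exp u"
    using filterlim_compose[OF \<tau>_lim] filterlim_compose[OF lim] by auto
  have \<gamma>p: "(\<lambda>n. \<gamma> (t' n)) \<longlonglongrightarrow> p" using s(2) by (simp add: o_def t'_def)
  have "isCont f p"
    using holomorphic_on_imp_continuous_on[OF holf] continuous_on_eq_continuous_at[OF open_UNIV] by blast
  then have "(\<lambda>n. f (\<gamma> (t' n))) \<longlonglongrightarrow> f p" using \<gamma>p by (rule isCont_tendsto_compose)
  then have fp: "f p = exp u" using t'_lim(2) LIMSEQ_unique by blast
  obtain e h N where e: "e > 0" and N: "open N" "p \<in> N" "inj_on f N" and h: "exp_lift f h (ball u e)"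
    and hN: "h ` ball u e \<subseteq> N"
    using exp_lift_local[OF holf noncritical fp] norm_exp_H[OF uH] fp by metis
  obtain e0 where e0: "e0 > 0" "ball u e0 \<subseteq> H" using open_H uH openE by blast
  define d where "d = min e e0"
  have d: "d > 0" "ball u d \<subseteq> H" "ball u d \<subseteq> ball u e" using e e0 by (auto simp: d_def)
  have "\<forall>\<^sub>F n in sequentially. \<gamma> (t' n) \<in> N" using \<gamma>p N topological_tendstoD by blast
  moreover have "\<forall>\<^sub>F n in sequentially. \<tau> (t' n) \<in> ball u d"
    using t'_lim(1) d(1) by (intro topological_tendstoD) auto
  ultimately have "\<forall>\<^sub>F n in sequentially. \<gamma> (t' n) \<in> N \<and> \<tau> (t' n) \<in> ball u d"
    by eventually_elim simp
  then obtain n where n: "\<gamma> (t' n) \<in> N" "\<tau> (t' n) \<in> ball u d"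
    using eventually_happens by force
  \<comment> \<open>One common value suffices: both points lie in \<open>N\<close>, where
    \<open>f\<close> is injective, and \<open>exp_lift_unique\<close> spreads the equality over the
    convex overlap.\<close>
  have "h (\<tau> (t' n)) = \<gamma> (t' n)"
  proof (rule inj_onD[OF N(3)])
    show "f (h (\<tau> (t' n))) = f (\<gamma> (t' n))" using h n d f\<gamma>[OF t'0] by (auto simp: exp_lift_def)
  qed (use n hN d in \<open>auto simp: image_subset_iff subset_iff\<close>)
  then have eq: "h (\<tau> (t' n)) = g (\<tau> (t' n))" by (simp add: \<gamma>_def)
  have "h w = g w" if "w \<in> ball u d \<inter> ball w0 r" for w
  proof (rule exp_lift_unique[of "ball u d \<inter> ball w0 r" h g "\<tau> (t' n)"])
    show "connected (ball u d \<inter> ball w0 r)" by (simp add: convex_Int convex_connected)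
    show "exp_lift f h (ball u d \<inter> ball w0 r)" using h d exp_lift_subset by blast
    show "exp_lift f g (ball u d \<inter> ball w0 r)" using g exp_lift_subset by blast
  qed (use d n \<tau>_ball[OF t'0] eq that in auto)
  moreover have "exp_lift f h (ball u d)" using h d exp_lift_subset by blast
  ultimately show ?thesis using d by blast
qed

text \<open>By compactness of the closed disc the local continuations exist on discs of one radius
  \<open>d\<close>. At \<open>v\<close> the extension uses the continuation about the closest point
  \<open>\<pi> v\<close> of the closed disc, so it is single-valued by construction; as
  \<open>\<pi>\<close> is 1-Lipschitz, neighbouring points use overlapping continuations, which
  gives holomorphy.\<close>

lemma exp_lift_extend:
  assumes r: "0 < r" "r < Re w0 - ln R" and g: "exp_lift f g (ball w0 r)"
  shows "\<exists>d>0. \<exists>h. exp_lift f h (ball w0 (r + d)) \<and> h w0 = g w0"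
proof -
  obtain e where e: "\<And>u. u \<in> cball w0 r \<Longrightarrow> e u > 0 \<and> (\<exists>h. ball u (e u) \<subseteq> H \<and>
      exp_lift f h (ball u (e u)) \<and> (\<forall>w\<in>ball u (e u) \<inter> ball w0 r. h w = g w))"
    using exp_lift_boundary[OF r g] by metis
  obtain d where d: "d > 0" "\<And>u. u \<in> cball w0 r \<Longrightarrow> \<exists>G\<in>(\<lambda>u. ball u (e u)) ` cball w0 r. ball u d \<subseteq> G"
  proof (rule Heine_Borel_lemma[of "cball w0 r" "(\<lambda>u. ball u (e u)) ` cball w0 r"])
    show "cball w0 r \<subseteq> \<Union> ((\<lambda>u. ball u (e u)) ` cball w0 r)"
      using e by (auto intro!: bexI)
  qed auto
  have "\<exists>h. ball u d \<subseteq> H \<and> exp_lift f h (ball u d) \<and> (\<forall>w\<in>ball u d \<inter> ball w0 r. h w = g w)"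
    if "u \<in> cball w0 r" for u
  proof -
    obtain v where v: "v \<in> cball w0 r" "ball u d \<subseteq> ball v (e v)" using d(2)[OF \<open>u \<in> _\<close>] by auto
    then show ?thesis using e[OF v(1)] exp_lift_subset by blast
  qed
  then obtain h where h: "\<And>u. u \<in> cball w0 r \<Longrightarrow> ball u d \<subseteq> H \<and> exp_lift f (h u) (ball u d) \<and>
      (\<forall>w\<in>ball u d \<inter> ball w0 r. h u w = g w)"
    by metis
  define \<pi> where "\<pi> = closest_point (cball w0 r)"
  have ne: "cball w0 r \<noteq> {}" using r by auto
  have \<pi>_in: "\<pi> v \<in> cball w0 r" for v
    unfolding \<pi>_def using ne by (intro closest_point_in_set) auto
  have \<pi>_lip: "dist (\<pi> v) (\<pi> v') \<le> dist v v'" for v v'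
    unfolding \<pi>_def using ne by (intro closest_point_lipschitz) auto
  \<comment> \<open>The overlap is a neighbourhood of \<open>u\<close>, which lies in the closure of
    the open disc; so it meets that disc, where both continuations equal \<open>g\<close>.\<close>
  have agree: "h u w = h u' w" if "u \<in> cball w0 r" "u' \<in> cball w0 r" "dist u u' < d"
      "w \<in> ball u d \<inter> ball u' d" for u u' w
  proof -
    let ?C = "ball u d \<inter> ball u' d"
    have "u \<in> closure (ball w0 r)" using that(1) r by simp
    moreover have "u \<in> ?C" using that(3) d by (auto simp: dist_commute)
    moreover have "open ?C" by auto
    ultimately have "?C \<inter> ball w0 r \<noteq> {}"
      by (metis closure_iff_nhds_not_empty Int_commute IntI empty_iff open_Int_closure_eq_empty)
    then obtain p where p: "p \<in> ?C" "p \<in> ball w0 r" by blast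
    show ?thesis
    proof (rule exp_lift_unique[of ?C "h u" "h u'" p])
      show "connected ?C" by (simp add: convex_Int convex_connected)
      show "h u p = h u' p" using p h that by auto
    qed (use p h that in \<open>auto intro: exp_lift_subset\<close>)
  qed
  define k where "k v = h (\<pi> v) v" for v
  have near: "dist v (\<pi> v) < d/2" if "v \<in> ball w0 (r + d/2)" for v
  proof (cases "v \<in> cball w0 r")
    case True
    then have "\<pi> v = v" by (simp add: \<pi>_def closest_point_self)
    then show ?thesis using d by simp
  next
    case False
    define q where "q = w0 + of_real (r / dist w0 v) * (v - w0)"
    have D: "dist w0 v > r" "dist w0 v < r + d/2" using False that by auto
    have "v \<noteq> w0" using D r by auto
    then have "dist w0 q = r" using D r by (simp add: q_def dist_norm norm_mult norm_minus_commute del: of_real_divide)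
    then have le: "dist v (\<pi> v) \<le> dist v q"
      unfolding \<pi>_def by (intro closest_point_le) auto
    have "v - q = of_real (1 - r / dist w0 v) * (v - w0)"
      by (simp add: q_def algebra_simps)
    moreover have "r / dist w0 v \<le> 1" using D r by (intro divide_le_eq_1_pos[THEN iffD2]) auto
    then have "0 \<le> 1 - r / dist w0 v" by simp
    ultimately have "dist v q = (1 - r / dist w0 v) * dist w0 v"
      by (simp add: dist_norm norm_mult norm_minus_commute[of w0] del: of_real_divide of_real_diff)
    also have "\<dots> = dist w0 v - r" using order.strict_trans[OF r(1) D(1)] by (simp add: left_diff_distrib)
    finally show ?thesis using D le by simp
  qed
  have k: "\<exists>e>0. ball v e \<subseteq> ball w0 (r + d/2) \<and> exp_lift f (h (\<pi> v)) (ball v e) \<and> (\<forall>v'\<in>ball v e. k v' = h (\<pi> v) v')"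
    if v: "v \<in> ball w0 (r + d/2)" for v
  proof -
    obtain e1 where e1: "e1 > 0" "ball v e1 \<subseteq> ball w0 (r + d/2)" using v open_ball openE by blast
    define e where "e = min e1 (d/2)"
    have e: "e > 0" "e \<le> e1" "e \<le> d/2" using e1 d by (auto simp: e_def)
    have sub: "ball v e \<subseteq> ball (\<pi> v) d"
    proof
      fix x assume "x \<in> ball v e"
      then have "dist v x < d/2" using e by simp
      then show "x \<in> ball (\<pi> v) d"
        using near[OF v] dist_triangle[of "\<pi> v" x v] by (simp add: dist_commute)
    qed
    have "k v' = h (\<pi> v) v'" if v': "v' \<in> ball v e" for v'
      unfolding k_def
    proof (rule agree[OF \<pi>_in \<pi>_in])
      show "dist (\<pi> v') (\<pi> v) < d"
        using \<pi>_lip[of v' v] v' e d by (simp add: dist_commute)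
      have "v' \<in> ball w0 (r + d/2)" using v' subset_ball[OF e(2)] e1(2) by blast
      then have "v' \<in> ball (\<pi> v') d" using near[of v'] d by (simp add: dist_commute)
      then show "v' \<in> ball (\<pi> v') d \<inter> ball (\<pi> v) d" using sub v' by blast
    qed
    moreover have "exp_lift f (h (\<pi> v)) (ball v e)" using h[OF \<pi>_in] sub exp_lift_subset by blast
    moreover have "ball v e \<subseteq> ball w0 (r + d/2)" using subset_ball[OF e(2)] e1(2) by blast
    ultimately show ?thesis using e by blast
  qed
  have "k holomorphic_on ball w0 (r + d/2)"
  proof (subst holomorphic_on_open, simp, intro ballI)
    fix v assume "v \<in> ball w0 (r + d/2)"
    then obtain e where e: "e > 0" "exp_lift f (h (\<pi> v)) (ball v e)" "\<forall>v'\<in>ball v e. k v' = h (\<pi> v) v'"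
      using k by blast
    then have "k holomorphic_on ball v e" unfolding exp_lift_def by (metis holomorphic_cong)
    then show "\<exists>k'. (k has_field_derivative k') (at v)"
      using e(1) by (metis holomorphic_on_open centre_in_ball open_ball)
  qed
  moreover have "f (k v) = exp v" if v: "v \<in> ball w0 (r + d/2)" for v
    using k[OF v] by (auto simp: exp_lift_def)
  moreover have "k w0 = g w0"
    using h[of w0] d r by (simp add: k_def \<pi>_def closest_point_self)
  ultimately show ?thesis
    using d by (intro exI[of _ "d/2"] conjI exI[of _ k]) (auto simp: exp_lift_def)
qed

text \<open>Continuity method: the lifts on smaller concentric discs glue to one on the disc of
  supremal radius, and if this radius were below the distance of \<open>w0\<close> from the boundary
  of \<open>H\<close>, that lift could be extended.\<close>

lemma exp_lift_ball:
  assumes w0: "w0 \<in> H" and z0: "f z0 = exp w0"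
  shows "\<exists>g. exp_lift f g (ball w0 (Re w0 - ln R)) \<and> g w0 = z0"
proof -
  define \<rho> where "\<rho> = Re w0 - ln R"
  have \<rho>: "\<rho> > 0" using w0 by (simp add: \<rho>_def H_def)
  define S where "S = {s. 0 < s \<and> s \<le> \<rho> \<and> (\<exists>g. exp_lift f g (ball w0 s) \<and> g w0 = z0)}"
  obtain e h where e: "e > 0" "exp_lift f h (ball w0 e)" "h w0 = z0"
    using exp_lift_local[OF holf noncritical z0] norm_exp_H[OF w0] z0 by metis
  have "exp_lift f h (ball w0 (min e \<rho>))" using e exp_lift_subset by (metis min.cobounded1 subset_ball)
  then have S_ne: "min e \<rho> \<in> S" using e(1,3) \<rho> unfolding S_def by (intro CollectI conjI exI[of _ h]) simp_all
  have bdd: "bdd_above S" by (auto simp: S_def bdd_above_def)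
  define r where "r = Sup S"
  have r: "0 < r" "r \<le> \<rho>"
  proof -
    have "min e \<rho> \<le> r" unfolding r_def using S_ne bdd by (rule cSup_upper)
    then show "0 < r" using e \<rho> by auto
    show "r \<le> \<rho>" unfolding r_def
    proof (rule cSup_least)
      show "S \<noteq> {}" using S_ne by blast
    qed (simp add: S_def)
  qed
  have Un: "(\<Union>s\<in>S. ball w0 s) = ball w0 r"
  proof
    show "(\<Union>s\<in>S. ball w0 s) \<subseteq> ball w0 r"
      using cSup_upper[OF _ bdd] by (force simp: r_def)
    show "ball w0 r \<subseteq> (\<Union>s\<in>S. ball w0 s)"
      using less_cSup_iff[OF _ bdd] S_ne by (force simp: r_def)
  qed
  have "\<exists>g. exp_lift f g (\<Union>((\<lambda>s. ball w0 s) ` S)) \<and> g w0 = z0"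
  proof (rule exp_lift_Union)
    fix U assume "U \<in> (\<lambda>s. ball w0 s) ` S"
    then obtain s where s: "s \<in> S" "U = ball w0 s" by blast
    then have "ball w0 s \<subseteq> H" by (intro ball_subset_H) (simp add: S_def \<rho>_def)
    then show "open U \<and> convex U \<and> w0 \<in> U \<and> U \<subseteq> H \<and> (\<exists>g. exp_lift f g U \<and> g w0 = z0)"
      using s by (auto simp: S_def)
  qed (use S_ne in auto)
  then obtain g where g: "exp_lift f g (ball w0 r)" "g w0 = z0" using Un by auto
  have "r = \<rho>"
  proof (rule ccontr)
    assume "r \<noteq> \<rho>"
    then have "r < \<rho>" using r by simp
    then obtain d h where d: "d > 0" "exp_lift f h (ball w0 (r + d))" "h w0 = z0"
      using exp_lift_extend[OF r(1) _ g(1)] g(2) by (auto simp: \<rho>_def)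
    have "exp_lift f h (ball w0 (min (r + d) \<rho>))"
      using d exp_lift_subset by (metis min.cobounded1 subset_ball)
    then have "min (r + d) \<rho> \<in> S" using d r \<rho> by (auto simp: S_def)
    then have "min (r + d) \<rho> \<le> r" unfolding r_def using bdd by (rule cSup_upper)
    then show False using d \<open>r < \<rho>\<close> by auto
  qed
  then show ?thesis using g by (auto simp: \<rho>_def)
qed

text \<open>The half-plane is exhausted by discs that touch its boundary at the same point; each of them
  contains the centre of the next one, so that the lift can be passed on.\<close>

lemma exp_lift_half_plane:
  assumes w1: "w1 \<in> H" and z1: "f z1 = exp w1"
  obtains g where "exp_lift f g H" "g w1 = z1"
proof -
  define s where "s = Re w1 - ln R"
  have s: "s > 0" using w1 by (simp add: s_def H_def)
  \<comment> \<open>Ratio 3/2: the next centre is half a radius away, hence inside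
    \<open>D n\<close>, while \<open>D n\<close> stays inside \<open>D (Suc n)\<close>.\<close>
  define c where "c n = Complex (ln R + s * (3/2)^n) (Im w1)" for n :: nat
  define D where "D n = ball (c n) (s * (3/2)^n)" for n
  have c0: "c 0 = w1" by (simp add: c_def s_def complex_eq_iff)
  have cH: "c n \<in> H" for n using s by (simp add: c_def H_def)
  have DH: "D n \<subseteq> H" for n unfolding D_def by (intro ball_subset_H) (simp add: c_def)
  have cd: "dist (c n) (c (Suc n)) = s * (3/2)^n / 2" for n
  proof -
    have "c (Suc n) - c n = of_real (s * (3/2)^n / 2)" by (simp add: c_def complex_eq_iff)
    then show ?thesis using s by (metis dist_commute dist_norm norm_of_real abs_of_nonneg zero_le_divide_iff
        zero_le_mult_iff less_imp_le zero_le_power zero_le_numeral)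
  qed
  have c_in: "c (Suc n) \<in> D n" for n 
  proof -
    have "0 < s * (3/2)^n" using s by simp
    then show ?thesis using cd[of n] by (simp add: D_def)
  qed
  have D_sub: "D n \<subseteq> D (Suc n)" for n
  proof
    fix x assume "x \<in> D n"
    then show "x \<in> D (Suc n)"
      using cd[of n] dist_triangle[of "c (Suc n)" x "c n"] by (simp add: D_def dist_commute)
  qed
  have w1D: "w1 \<in> D n" for n
  proof (induction n)
    case 0
    then show ?case using c0 s by (simp add: D_def)
  qed (use D_sub in blast)
  have lift: "\<exists>g. exp_lift f g (D n) \<and> g w1 = z1" for n
  proof (induction n)
    case 0
    then show ?case using exp_lift_ball[OF w1 z1] c0 by (simp add: D_def s_def)
  next
    case (Suc n)
    then obtain g where g: "exp_lift f g (D n)" "g w1 = z1" by blast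
    have "f (g (c (Suc n))) = exp (c (Suc n))" using g c_in by (simp add: exp_lift_def)
    then obtain h where h: "exp_lift f h (D (Suc n))" "h (c (Suc n)) = g (c (Suc n))"
      using exp_lift_ball[OF cH, of "g (c (Suc n))" "Suc n"] by (auto simp: D_def c_def)
    have "h w1 = g w1"
      by (rule exp_lift_unique[of "D n" h g "c (Suc n)"])
        (use h g DH D_sub c_in w1D exp_lift_subset in \<open>auto simp: D_def\<close>)
    then show ?case using h g by auto
  qed
  have "\<exists>g. exp_lift f g (\<Union>(range D)) \<and> g w1 = z1"
    by (rule exp_lift_Union) (use lift DH w1D in \<open>auto simp: D_def\<close>)
  moreover have "H \<subseteq> \<Union>(range D)"
  proof
    fix x assume x: "x \<in> H"
    define a where "a = Re x - ln R"
    define b where "b = Im x - Im w1"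
    have a: "a > 0" using x by (simp add: a_def H_def)
    \<comment> \<open>With \<open>t\<close> the radius of \<open>D n\<close>, membership of
      \<open>x\<close> reads \<open>(a - t)^2 + b^2 < t^2\<close>, that is
      \<open>a^2 + b^2 < 2 * a * t\<close>, which holds for large \<open>t\<close> because
      \<open>a > 0\<close>.\<close>
    obtain n where n: "(a^2 + b^2) / (2 * a * s) < (3/2)^n"
      using real_arch_pow[of "3/2"] by auto
    define t where "t = s * (3/2)^n"
    have t: "t > 0" using s by (simp add: t_def)
    have "a^2 + b^2 < 2 * a * t" using n a s by (simp add: t_def field_simps)
    then have "(a - t)^2 + b^2 < t^2" by (simp add: power2_eq_square algebra_simps)
    moreover have "(norm (x - c n))^2 = (a - t)^2 + b^2"
      by (simp add: cmod_power2 c_def a_def b_def t_def algebra_simps)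
    ultimately have "norm (x - c n) < t" using t by (metis power2_less_imp_less less_imp_le)
    then have "x \<in> D n" by (simp add: D_def t_def dist_norm norm_minus_commute)
    then show "x \<in> \<Union>(range D)" by blast
  qed
  ultimately show ?thesis using that exp_lift_subset by blast
qed

end

section \<open>Univalence and contraction of logarithmic branches\<close>

lemma entire_tends_to_infinity_imp_poly:
  assumes "f holomorphic_on UNIV" and "filterlim f at_infinity at_infinity"
  shows "\<exists>p. \<forall>z. f z = poly p z"
proof -
  have "((inverse \<circ> f) \<longlongrightarrow> 0) at_infinity"
    using filterlim_compose[OF tendsto_inverse_0 assms(2)] by (simp add: o_def)
  then obtain a n where "\<And>z. f z = (\<Sum>i\<le>n. a i * z^i)"
    using pole_at_infinity[OF assms(1)] by blast
  then have "f z = poly (\<Sum>i\<le>n. monom (a i) i) z" for z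
    by (simp add: poly_sum poly_monom)
  then show ?thesis by blast
qed

text \<open>The bound on \<open>f 0\<close> keeps lifts over \<open>H\<close> away from 0, so that
  they have logarithms; \<open>not_poly\<close> rules out a pole at infinity.\<close>

locale log_coordinates = no_singular_values_outside +
  assumes R_ge_1: "R \<ge> 1"
    and f0: "norm (f 0) < R"
    and not_poly: "\<not> (\<exists>p. \<forall>z. f z = poly p z)"
begin

lemma lnR: "ln R \<ge> 0" using R_ge_1 by simp

lemma f_bounded_on_cball: "\<exists>C>0. \<forall>z\<in>cball a B. norm (f z) \<le> C"
proof -
  have "compact (f ` cball a B)"
    using holf by (intro compact_continuous_image) (auto intro: holomorphic_on_imp_continuous_on holomorphic_on_subset)
  then obtain C where "C > 0" "\<forall>y\<in>f ` cball a B. norm y \<le> C"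
    using compact_imp_bounded bounded_pos by blast
  then show ?thesis by (intro exI[of _ C]) auto
qed

text \<open>The image \<open>S\<close> is open. Away from the image of one period of the line
  \<open>Re w = x0\<close>, which is bounded, it is also relatively closed: near a limit point
  \<open>f\<close> is bounded, which bounds \<open>Re w\<close>, and periodicity bounds
  \<open>Im w\<close>, so the approximating values come from a compact set. The exterior of a disc
  is connected, hence contained in \<open>S\<close>.\<close>

lemma periodic_lift_image_nhds_infinity:
  assumes g: "exp_lift f g H" and p: "Re p = 0" "Im p \<noteq> 0"
    and per: "\<And>w. w \<in> H \<Longrightarrow> g (w + p) = g w" and x0: "ln R < x0"
  shows "\<exists>B. \<forall>z. B < norm z \<longrightarrow> z \<in> g ` {w. x0 < Re w}"
proof -
  have per_nat: "g (w + of_nat m * p) = g w" if "w \<in> H" for w m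
  proof (induction m)
    case (Suc m)
    have "w + of_nat m * p \<in> H" using that p by (simp add: H_def)
    then have "g (w + of_nat m * p + p) = g w" using Suc per by simp
    then show ?case by (simp add: algebra_simps)
  qed simp
  have per_int: "g (w + of_int m * p) = g w" if "w \<in> H" for w m
  proof (cases "m \<ge> 0")
    case True
    then show ?thesis using per_nat[OF that, of "nat m"] by simp
  next
    case False
    have "w + of_int m * p \<in> H" using that p by (simp add: H_def)
    then have "g (w + of_int m * p + of_nat (nat (-m)) * p) = g (w + of_int m * p)"
      by (rule per_nat)
    then show ?thesis using False by (simp add: algebra_simps)
  qed
  define \<phi> where "\<phi> = (\<lambda>(x, t). complex_of_real x + of_real t * p)"
  have \<phi>_cont: "continuous_on S \<phi>" for S
    unfolding \<phi>_def split_def by (intro continuous_intros)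
  have reduce: "\<exists>t\<in>{0..1}. g w = g (\<phi> (Re w, t))" if "w \<in> H" for w
  proof
    define y where "y = Im w / Im p"
    show "frac y \<in> {0..1}" using frac_lt_1[of y] frac_ge_0[of y] by auto
    have "Im w = Im p * frac y + Im p * of_int \<lfloor>y\<rfloor>"
      using p by (simp add: y_def frac_def field_simps)
    then have "w = \<phi> (Re w, frac y) + of_int \<lfloor>y\<rfloor> * p"
      using p by (simp add: complex_eq_iff \<phi>_def algebra_simps)
    moreover have "\<phi> (Re w, frac y) \<in> H" using that p by (simp add: \<phi>_def H_def)
    ultimately show "g w = g (\<phi> (Re w, frac y))" using per_int by metis
  qed
  have contg: "continuous_on H g" using g holomorphic_on_imp_continuous_on by (auto simp: exp_lift_def)
  have comp: "compact (g ` \<phi> ` ({x0..X} \<times> {0..1}))" for X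
  proof (intro compact_continuous_image \<phi>_cont compact_Times continuous_on_subset[OF contg])
    show "\<phi> ` ({x0..X} \<times> {0..1}) \<subseteq> H" using x0 p by (auto simp: \<phi>_def H_def)
  qed auto
  obtain B where B: "\<And>z. z \<in> g ` \<phi> ` ({x0..x0} \<times> {0..1}) \<Longrightarrow> norm z \<le> B"
    using compact_imp_bounded[OF comp] bounded_iff by metis
  define S where "S = g ` {w. x0 < Re w}"
  define V where "V = - cball (0::complex) B"
  have sub: "{w. x0 < Re w} \<subseteq> H" using x0 by (auto simp: H_def)
  have "\<not> g constant_on H"
  proof
    assume "g constant_on H"
    then obtain c where c: "\<And>w. w \<in> H \<Longrightarrow> g w = c" by (auto simp: constant_on_def)
    have "of_real x0 \<in> H" "of_real (x0 + 1) \<in> H" using x0 by (auto simp: H_def)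
    then have "exp (complex_of_real x0) = exp (of_real (x0 + 1))"
      using g c by (metis exp_lift_def)
    then show False by (metis exp_of_real exp_inj_iff of_real_eq_iff less_add_one less_irrefl)
  qed
  moreover have "open {w. x0 < Re w}" by (simp add: open_halfspace_Re_gt)
  ultimately have openS: "open S"
    unfolding S_def using open_mapping_thm[of g H] g open_H convex_H convex_connected sub
    by (auto simp: exp_lift_def)
  have "V \<inter> closure S \<subseteq> S"
  proof
    fix z assume z: "z \<in> V \<inter> closure S"
    obtain C where C: "C > 0" "\<And>y. y \<in> cball z 1 \<Longrightarrow> norm (f y) \<le> C" using f_bounded_on_cball by metis
    define Q where "Q = g ` \<phi> ` ({x0..ln C} \<times> {0..1})"
    have "S \<inter> ball z 1 \<subseteq> Q"
    proof
      fix y assume y: "y \<in> S \<inter> ball z 1"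
      then obtain w where w: "x0 < Re w" "y = g w" by (auto simp: S_def)
      have wH: "w \<in> H" using w x0 by (simp add: H_def)
      have "norm (f y) = exp (Re w)" using g w wH by (simp add: exp_lift_def)
      then have "exp (Re w) \<le> C" using C(2)[of y] y by auto
      then have "Re w \<le> ln C" using C(1) by (simp add: ln_ge_iff)
      then show "y \<in> Q" using reduce[OF wH] w by (auto simp: Q_def)
    qed
    then have "closure (S \<inter> ball z 1) \<subseteq> Q"
      by (rule closure_minimal) (use comp compact_imp_closed in \<open>auto simp: Q_def\<close>)
    moreover have "z \<in> closure (S \<inter> ball z 1)"
    proof -
      have "ball z 1 \<inter> closure S \<subseteq> closure (ball z 1 \<inter> S)"
        by (rule open_Int_closure_subset) simp
      then show ?thesis using z by (auto simp: Int_commute)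
    qed
    ultimately have "z \<in> Q" by blast
    then obtain x t where xt: "x \<ge> x0" "t \<in> {0..1}" "z = g (\<phi> (x, t))" by (auto simp: Q_def)
    have "x \<noteq> x0"
    proof
      assume "x = x0"
      then have "norm z \<le> B" using xt by (intro B) auto
      then show False using z by (auto simp: V_def)
    qed
    then have "x0 < Re (\<phi> (x, t))" using xt p by (simp add: \<phi>_def)
    then show "z \<in> S" using xt by (auto simp: S_def)
  qed
  then have VS: "V - closure S = V - S" using closure_subset by auto
  have "connected V" unfolding V_def by (intro connected_complement_bounded_convex) auto
  moreover have "open (V \<inter> S)" "open (V - closure S)" using openS by (auto simp: V_def)
  moreover have "V \<inter> S \<noteq> {}"
  proof -
    obtain C where C: "C > 0" "\<And>y. y \<in> cball 0 B \<Longrightarrow> norm (f y) \<le> C" using f_bounded_on_cball by metis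
    define w where "w = complex_of_real (max x0 (ln C) + 1)"
    have w: "x0 < Re w" "w \<in> H" using x0 by (auto simp: w_def H_def)
    have "norm (f (g w)) = exp (max x0 (ln C) + 1)" using g w by (simp add: exp_lift_def) (simp add: w_def)
    also have "\<dots> > exp (ln C)" by (subst exp_less_cancel_iff) auto
    finally have "norm (f (g w)) > C" using C by simp
    then have "g w \<in> V" using C(2)[of "g w"] by (auto simp: V_def)
    moreover have "g w \<in> S" using w by (auto simp: S_def)
    ultimately show ?thesis by blast
  qed
  ultimately have "V - S = {}"
    using VS connectedD[of V "V \<inter> S" "V - closure S"] by auto
  then show ?thesis by (intro exI[of _ B]) (auto simp: V_def S_def)
qed

text \<open>If the lift took a value twice it would be periodic and would parametrise a punctured
  neighbourhood of infinity; then \<open>f\<close> has a pole there.\<close>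

lemma exp_lift_inj:
  assumes g: "exp_lift f g H"
  shows "inj_on g H"
proof (rule inj_onI, rule ccontr)
  fix w1 w2 assume w: "w1 \<in> H" "w2 \<in> H" "g w1 = g w2" "w1 \<noteq> w2"
  define p where "p = w1 - w2"
  have e: "exp w1 = exp w2" using w g by (metis exp_lift_def)
  then have p: "Re p = 0" "exp p = 1"
    by (auto simp: p_def exp_diff) (metis exp_inj_iff norm_exp_eq_Re)
  then have p0: "Im p \<noteq> 0" using w by (auto simp: p_def complex_eq_iff)
  have pH: "w + p \<in> H \<longleftrightarrow> w \<in> H" for w using p by (simp add: H_def)
  \<comment> \<open>\<open>p\<close> is a multiple of \<open>2 \<pi> i\<close>, so the translate of
    \<open>g\<close> is again a lift, and it agrees with \<open>g\<close> at
    \<open>w2\<close>.\<close>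
  have "exp_lift f (\<lambda>w. g (w + p)) H"
  proof -
    have "(g \<circ> (\<lambda>w. w + p)) holomorphic_on H"
      using g pH by (intro holomorphic_on_compose_gen[of _ _ _ H] holomorphic_intros) (auto simp: exp_lift_def)
    then show ?thesis using g pH p by (auto simp: exp_lift_def o_def exp_add)
  qed
  then have per: "g (w + p) = g w" if "w \<in> H" for w
    using exp_lift_unique[of H "\<lambda>w. g (w + p)" g w2 w] that g open_H convex_H w
    by (auto simp: convex_connected p_def)
  have "filterlim f at_infinity at_infinity"
  proof (subst filterlim_at_infinity[of 0], simp, intro allI impI)
    fix r :: real assume "0 < r"
    define x0 where "x0 = max (ln R) (ln r) + 1"
    have "ln R < x0" by (simp add: x0_def)
    then obtain B where B: "\<And>z. B < norm z \<Longrightarrow> z \<in> g ` {w. x0 < Re w}"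
      using periodic_lift_image_nhds_infinity[OF g p(1) p0 per] by blast
    have "r \<le> norm (f z)" if zB: "B < norm z" for z
    proof -
      obtain w where w: "x0 < Re w" "z = g w" using B[OF zB] by auto
      then have "norm (f z) = exp (Re w)" using g by (simp add: exp_lift_def H_def x0_def)
      moreover have "exp (ln r) \<le> exp (Re w)" using w by (subst exp_le_cancel_iff) (simp add: x0_def)
      ultimately show ?thesis using \<open>0 < r\<close> by simp
    qed
    then show "\<forall>\<^sub>F z in at_infinity. r \<le> norm (f z)"
      unfolding eventually_at_infinity by (intro exI[of _ "B + 1"]) auto
  qed
  then show False using entire_tends_to_infinity_imp_poly[OF holf] not_poly by blast
qed

text \<open>The injectivity recorded is that of \<open>exp o \<Phi>\<close>, the lift itself; it is
  stronger than injectivity of \<open>\<Phi>\<close> and says that no two distinct points of the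
  image differ by a multiple of \<open>2 \<pi> i\<close>.\<close>

lemma log_branch:
  assumes v: "v \<in> H" and u: "f (exp u) = exp v"
  obtains \<Phi> where "\<Phi> holomorphic_on H" "\<Phi> v = u" "\<And>w. w \<in> H \<Longrightarrow> f (exp (\<Phi> w)) = exp w"
    "inj_on (\<lambda>w. exp (\<Phi> w)) H"
proof -
  obtain g where g: "exp_lift f g H" "g v = exp u" using exp_lift_half_plane[OF v u] .
  have "g w \<noteq> 0" if "w \<in> H" for w
    using g norm_exp_H[OF that] f0 that by (metis exp_lift_def less_asym)
  then obtain L where L: "L holomorphic_on H" "\<And>w. w \<in> H \<Longrightarrow> exp (L w) = g w"
    using holomorphic_logarithm_exists[OF convex_H open_H, of g v] g v by (auto simp: exp_lift_def)
  define \<Phi> where "\<Phi> w = L w + (u - L v)" for w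
  have "exp (u - L v) = 1" using L(2)[OF v] g(2) by (simp add: exp_diff)
  then have e: "exp (\<Phi> w) = g w" if "w \<in> H" for w using L(2)[OF that] by (simp add: \<Phi>_def exp_add)
  show ?thesis
  proof (rule that)
    show "\<Phi> holomorphic_on H" unfolding \<Phi>_def by (intro holomorphic_intros L)
    show "\<Phi> v = u" by (simp add: \<Phi>_def)
    show "f (exp (\<Phi> w)) = exp w" if "w \<in> H" for w using e[OF that] g that by (simp add: exp_lift_def)
    show "inj_on (\<lambda>w. exp (\<Phi> w)) H" using exp_lift_inj[OF g(1)] e by (simp add: inj_on_def)
  qed
qed

text \<open>The image of a logarithmic branch contains no vertical segment of length \<open>2\<pi>\<close>, hence no
  large disc.\<close>

lemma log_branch_deriv:
  assumes \<Phi>: "\<Phi> holomorphic_on H" "inj_on (\<lambda>w. exp (\<Phi> w)) H" and w: "w \<in> H"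
  shows "norm (deriv \<Phi> w) * (Re w - ln R) \<le> 12 * pi"
proof (rule ccontr)
  assume *: "\<not> ?thesis"
  define r where "r = Re w - ln R"
  have r: "r > 0" using w by (simp add: r_def H_def)
  have sub: "ball w r \<subseteq> H" by (rule ball_subset_H) (simp add: r_def)
  \<comment> \<open>Bloch's theorem with constant 1/12. A radius above \<open>pi\<close> puts both
    \<open>b + \<i> * pi\<close> and \<open>b - \<i> * pi\<close> into the image, and these have the
    same exponential.\<close>
  obtain b where b: "ball b (r * norm (deriv \<Phi> w) / 12) \<subseteq> \<Phi> ` ball w r"
    using Bloch[OF holomorphic_on_subset[OF \<Phi>(1) sub] r order_refl] .
  have "r * norm (deriv \<Phi> w) / 12 > pi" using * by (simp add: r_def mult.commute)
  then have "b + \<i> * pi \<in> \<Phi> ` ball w r" "b - \<i> * pi \<in> \<Phi> ` ball w r"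
    using b by (auto intro!: subsetD[OF b] simp: dist_norm norm_mult)
  then obtain x y where xy: "x \<in> ball w r" "y \<in> ball w r" "b + \<i> * pi = \<Phi> x" "b - \<i> * pi = \<Phi> y"
    by auto
  have "\<Phi> x = \<Phi> y + \<i> * (of_real pi * 2)" using xy(3,4) by (simp add: algebra_simps flip: xy(3,4))
  then have "exp (\<Phi> x) = exp (\<Phi> y)" using exp_plus_2pin[of "\<Phi> y" 1] by (simp add: mult_ac)
  then have "x = y" using inj_onD[OF \<Phi>(2)] sub xy(1,2) by blast
  then have "\<i> * pi = - (\<i> * complex_of_real pi)" using xy(3,4) by (metis add_left_cancel diff_conv_add_uminus)
  then show False by (simp add: complex_eq_iff)
qed

text \<open>The disc keeps at least the distance \<open>d\<close> from the boundary of
  \<open>H\<close>, so on it the derivative is at most \<open>12 * pi / d\<close>.\<close>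

lemma log_branch_ball:
  assumes u: "f (exp w) = exp v" and s: "s > 0" "d > 0" "s + d \<le> Re v - ln R"
  obtains \<Phi> where "\<Phi> holomorphic_on ball v s" "\<Phi> v = w" "\<And>y. y \<in> ball v s \<Longrightarrow> f (exp (\<Phi> y)) = exp y"
    "inj_on \<Phi> (ball v s)" "\<Phi> ` ball v s \<subseteq> ball w (12 * pi * s / d)"
proof -
  have v: "v \<in> H" using s by (simp add: H_def)
  have sub: "ball v s \<subseteq> H" using s by (intro ball_subset_H) auto
  obtain \<Phi> where \<Phi>: "\<Phi> holomorphic_on H" "\<Phi> v = w" "\<And>w. w \<in> H \<Longrightarrow> f (exp (\<Phi> w)) = exp w"
    "inj_on (\<lambda>w. exp (\<Phi> w)) H"
    using log_branch[OF v u] by blast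
  have B: "norm (deriv \<Phi> y) \<le> 12 * pi / d" if y: "y \<in> ball v s" for y
  proof -
    have "Re v - Re y \<le> norm (v - y)" using complex_Re_le_cmod[of "v - y"] by simp
    then have d: "d \<le> Re y - ln R" using y s by (simp add: dist_norm)
    have "norm (deriv \<Phi> y) * d \<le> norm (deriv \<Phi> y) * (Re y - ln R)" using d by (intro mult_left_mono) auto
    also have "\<dots> \<le> 12 * pi" using log_branch_deriv[OF \<Phi>(1,4)] y sub by auto
    finally show ?thesis using s by (simp add: field_simps)
  qed
  have "\<Phi> y \<in> ball w (12 * pi * s / d)" if y: "y \<in> ball v s" for y
  proof -
    have "norm (\<Phi> y - \<Phi> v) \<le> (12 * pi / d) * norm (y - v)"
    proof (rule field_differentiable_bound[of "ball v s" \<Phi> "deriv \<Phi>"])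
      show "(\<Phi> has_field_derivative deriv \<Phi> z) (at z within ball v s)" if "z \<in> ball v s" for z
        using holomorphic_derivI[OF \<Phi>(1) open_H] that sub by blast
    qed (use B y s in auto)
    also have "\<dots> < (12 * pi / d) * s" using y s by (intro mult_strict_left_mono) (auto simp: dist_norm norm_minus_commute)
    finally show ?thesis using \<Phi>(2) by (simp add: dist_norm norm_minus_commute)
  qed
  moreover have "inj_on \<Phi> (ball v s)" by (rule inj_onI) (metis \<Phi>(4) inj_onD sub subsetD)
  ultimately show ?thesis
    using that[of \<Phi>] \<Phi> sub holomorphic_on_subset by blast
qed

text \<open>The radius \<open>24 * pi\<close> reproduces itself. The large disc about
  \<open>v\<close> is pulled back once, with \<open>s = Re v / 2\<close> and
  \<open>d = Re v / 4\<close>, into radius \<open>24 * pi\<close>; every further step has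
  \<open>s = d = 24 * pi\<close> and gives radius \<open>12 * pi\<close>. The hypothesis on
  \<open>M\<close> leaves room for both choices and keeps discs of radius \<open>24 * pi\<close>
  about large points to the right of \<open>ln R\<close>, so that no pulled-back point enters the
  small disc too early.\<close>

lemma iterate_branch:
  assumes M: "4 * (ln R + 24 * pi) \<le> M"
  shows "n \<ge> 1 \<Longrightarrow> (\<And>j. j \<le> n \<Longrightarrow> exp M \<le> norm ((f ^^ j) (exp w))) \<Longrightarrow> (f ^^ n) (exp w) = exp v \<Longrightarrow>
    \<exists>\<Psi>. \<Psi> holomorphic_on ball v (Re v / 2) \<and> inj_on \<Psi> (ball v (Re v / 2)) \<and> \<Psi> v = w \<and>
      \<Psi> ` ball v (Re v / 2) \<subseteq> ball w (24 * pi) \<and>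
      (\<forall>u\<in>ball v (Re v / 2). (f ^^ n) (exp (\<Psi> u)) = exp u \<and> (\<forall>j\<le>n. R \<le> norm ((f ^^ j) (exp (\<Psi> u)))))"
proof (induction n arbitrary: w rule: nat_induct_at_least)
  have M': "4 * ln R + 96 * pi \<le> M" "0 < pi" using M by simp_all
  have large: "R \<le> norm (exp y)" if "y \<in> ball x (24 * pi)" "M \<le> Re x" for x y :: complex
  proof -
    have "Re x - Re y \<le> norm (x - y)" using complex_Re_le_cmod[of "x - y"] by simp
    moreover have "norm (x - y) < 24 * pi" using that by (simp add: dist_norm)
    ultimately have "ln R \<le> Re y" using that(2) M' lnR by linarith
    then have "exp (ln R) \<le> exp (Re y)" by simp
    then show ?thesis using R_pos by simp
  qed
  have Re_ge: "M \<le> Re x" if "exp M \<le> norm (exp x)" for x :: complex using that by simp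
  {
    case base
    have Rew: "M \<le> Re w" using base(1)[of 0] by simp
    have Rev: "M \<le> Re v" using base(1)[of 1] base(2) by simp
    have x: "Re v > 0" "Re v / 4 \<ge> ln R" using Rev M' lnR by linarith+
    obtain \<Phi> where \<Phi>: "\<Phi> holomorphic_on ball v (Re v / 2)" "\<Phi> v = w"
      "\<And>y. y \<in> ball v (Re v / 2) \<Longrightarrow> f (exp (\<Phi> y)) = exp y"
      "inj_on \<Phi> (ball v (Re v / 2))" "\<Phi> ` ball v (Re v / 2) \<subseteq> ball w (12 * pi * (Re v / 2) / (Re v / 4))"
      using log_branch_ball[of w v "Re v / 2" "Re v / 4"] base(2) x by force
    have img: "\<Phi> ` ball v (Re v / 2) \<subseteq> ball w (24 * pi)" using \<Phi>(5) x by simp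
    have "R \<le> norm ((f ^^ j) (exp (\<Phi> u)))" if u: "u \<in> ball v (Re v / 2)" and "j \<le> 1" for u j
    proof (cases "j = 0")
      case True
      have "\<Phi> u \<in> ball w (24 * pi)" using img u by blast
      then show ?thesis using large[OF _ Rew] True by simp
    next
      case False
      then have "j = 1" using that by simp
      moreover have "R \<le> norm (exp u)"
      proof -
        have "Re v - Re u \<le> norm (v - u)" using complex_Re_le_cmod[of "v - u"] by simp
        then have "ln R \<le> Re u" using u x by (simp add: dist_norm)
        then have "exp (ln R) \<le> exp (Re u)" by simp
        then show ?thesis using R_pos by simp
      qed
      ultimately show ?thesis using \<Phi>(3)[OF u] by simp
    qed
    then show ?case using \<Phi> img by (intro exI[of _ \<Phi>]) auto
  next
    case (Suc n)
    have Rew: "M \<le> Re w" using Suc.prems(1)[of 0] by simp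
    have "norm (f (exp w)) \<ge> exp M" using Suc.prems(1)[of 1] by simp
    then have "f (exp w) \<noteq> 0" by (metis exp_gt_zero norm_zero not_le)
    then obtain w' where w': "f (exp w) = exp w'" by (metis exp_Ln)
    have it: "(f ^^ j) (exp w') = (f ^^ Suc j) (exp w)" for j by (simp add: funpow_swap1 w')
    have Rew': "M \<le> Re w'" using Suc.prems(1)[of 1] w' by simp
    obtain \<Psi> where \<Psi>: "\<Psi> holomorphic_on ball v (Re v / 2)" "inj_on \<Psi> (ball v (Re v / 2))" "\<Psi> v = w'"
      "\<Psi> ` ball v (Re v / 2) \<subseteq> ball w' (24 * pi)"
      "\<And>u. u \<in> ball v (Re v / 2) \<Longrightarrow> (f ^^ n) (exp (\<Psi> u)) = exp u"
      "\<And>u j. u \<in> ball v (Re v / 2) \<Longrightarrow> j \<le> n \<Longrightarrow> R \<le> norm ((f ^^ j) (exp (\<Psi> u)))"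
      using Suc.IH[of w'] Suc.prems it by (metis Suc_le_mono)
    obtain \<Phi> where \<Phi>: "\<Phi> holomorphic_on ball w' (24 * pi)" "\<Phi> w' = w"
      "\<And>y. y \<in> ball w' (24 * pi) \<Longrightarrow> f (exp (\<Phi> y)) = exp y"
      "inj_on \<Phi> (ball w' (24 * pi))" "\<Phi> ` ball w' (24 * pi) \<subseteq> ball w (12 * pi * (24 * pi) / (24 * pi))"
    proof (rule log_branch_ball[OF w', of "24 * pi" "24 * pi"])
      show "24 * pi + 24 * pi \<le> Re w' - ln R" using M' Rew' lnR by linarith
    qed auto
    have img: "\<Phi> ` ball w' (24 * pi) \<subseteq> ball w (24 * pi)" using \<Phi>(5) subset_ball[of "12 * pi" "24 * pi" w] by simp
    have "(\<Phi> \<circ> \<Psi>) holomorphic_on ball v (Re v / 2)"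
      using \<Psi> \<Phi> by (intro holomorphic_on_compose_gen) auto
    moreover have "inj_on (\<Phi> \<circ> \<Psi>) (ball v (Re v / 2))"
      using \<Psi> \<Phi> by (intro comp_inj_on) (auto intro: inj_on_subset)
    moreover have "(\<Phi> \<circ> \<Psi>) ` ball v (Re v / 2) \<subseteq> ball w (24 * pi)" using \<Psi>(4) img by (auto simp: image_subset_iff)
    moreover have it': "(f ^^ Suc j) (exp ((\<Phi> \<circ> \<Psi>) u)) = (f ^^ j) (exp (\<Psi> u))" if "u \<in> ball v (Re v / 2)" for u j
      using \<Phi>(3)[of "\<Psi> u"] \<Psi>(4) that by (auto simp: funpow_swap1 image_subset_iff)
    moreover have "R \<le> norm ((f ^^ j) (exp ((\<Phi> \<circ> \<Psi>) u)))" if u: "u \<in> ball v (Re v / 2)" and j: "j \<le> Suc n" for u j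
    proof (cases j)
      case 0
      have "(\<Phi> \<circ> \<Psi>) u \<in> ball w (24 * pi)" using \<Psi>(4) img u by (simp add: image_subset_iff)
      then show ?thesis using large[OF _ Rew] 0 by simp
    next
      case (Suc i)
      then show ?thesis using it'[OF u] \<Psi>(6)[OF u] j by simp
    qed
    moreover have "(\<Phi> \<circ> \<Psi>) v = w" using \<Psi>(3) \<Phi>(2) by simp
    ultimately show ?case
      using \<Psi>(5) by (intro exI[of _ "\<Phi> \<circ> \<Psi>"] conjI ballI) (auto simp del: comp_apply)
  }
qed

end

subsection \<open>Distortion and area under univalent maps\<close>

text \<open>Otherwise the circle of radius 2 lies in the image, which is simply connected, and so
  does the disc that it bounds. The inverse map would then send a disc of radius 2 into the closed
  unit disc with derivative 1 at the origin, against Cauchy's bound 1/2.\<close>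

lemma normalized_univalent_omits:
  assumes F: "F holomorphic_on ball 0 1" "inj_on F (ball 0 1)" and F0: "F 0 = 0" "deriv F 0 = 1"
  shows "\<exists>a. norm a = 2 \<and> a \<notin> F ` ball 0 1"
proof (rule ccontr)
  assume no: "\<not> ?thesis"
  define S where "S = F ` ball 0 1"
  have sph: "sphere 0 2 \<subseteq> S" using no by (auto simp: S_def)
  obtain G where G: "G holomorphic_on S" "\<And>z. z \<in> ball 0 1 \<Longrightarrow> deriv F z * deriv G (F z) = 1"
    "\<And>z. z \<in> ball 0 1 \<Longrightarrow> G (F z) = z"
    using holomorphic_has_inverse[OF F(1) open_ball F(2)] unfolding S_def by blast
  have "homeomorphism (ball 0 1) S F G"
    unfolding homeomorphism_def S_def using F G
    by (auto simp: S_def intro!: holomorphic_on_imp_continuous_on simp: image_iff)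
  then have "simply_connected S"
    using homeomorphic_simply_connected[of "ball 0 1" S] convex_imp_simply_connected[OF convex_ball]
    by (auto simp: homeomorphic_def)
  then have w0: "winding_number (circlepath 0 2) b = 0" if "b \<notin> S" for b
    using simply_connected_imp_winding_number_zero[of S "circlepath 0 2" b] sph that by auto
  have "ball 0 2 \<subseteq> S"
  proof
    fix b :: complex assume "b \<in> ball 0 2"
    then have "winding_number (circlepath 0 2) b = 1" by (intro winding_number_circlepath) auto
    then show "b \<in> S" using w0[of b] by auto
  qed
  then have sub: "cball 0 2 \<subseteq> S"
  proof (intro subsetI)
    fix b :: complex assume "ball 0 2 \<subseteq> S" "b \<in> cball 0 2"
    moreover have "b \<in> ball 0 2 \<or> b \<in> sphere 0 2" using calculation(2) by auto
    ultimately show "b \<in> S" using sph by blast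
  qed
  have "norm ((deriv ^^ 1) G 0) \<le> fact 1 * 1 / 2 ^ 1"
  proof (rule Cauchy_inequality)
    show "G holomorphic_on ball 0 2" using G(1) sub by (meson ball_subset_cball holomorphic_on_subset order_trans)
    show "continuous_on (cball 0 2) G" using G(1) sub by (meson holomorphic_on_imp_continuous_on holomorphic_on_subset)
    fix x :: complex assume "norm (0 - x) = 2"
    then have "x \<in> S" using sph by auto
    then show "norm (G x) \<le> 1" using G(3) by (auto simp: S_def)
  qed simp
  moreover have "deriv G 0 = 1" using G(2)[of 0] F0 by simp
  ultimately show False by simp
qed

text \<open>Maximum principle for \<open>z / F z\<close>, which is holomorphic with value 1 at the
  origin because \<open>F\<close> vanishes only there.\<close>

lemma normalized_univalent_min_on_sphere:
  assumes F: "F holomorphic_on ball 0 1" "inj_on F (ball 0 1)" and F0: "F 0 = 0" "deriv F 0 = 1"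
    and t: "0 < t" "t < 1"
  shows "\<exists>z. norm z = t \<and> norm (F z) \<le> t"
proof (rule ccontr)
  assume no: "\<not> ?thesis"
  define q where "q z = (if z = 0 then 1 else F z / z)" for z
  have "q holomorphic_on ball 0 1"
    by (rule pole_theorem_open_0[OF F(1)]) (auto simp: q_def F0)
  moreover have q0: "q z \<noteq> 0" if "z \<in> ball 0 1" for z
  proof (cases "z = 0")
    case False
    then have "F z \<noteq> F 0" using inj_onD[OF F(2), of z 0] that by auto
    then show ?thesis using False F0 by (simp add: q_def)
  qed (simp add: q_def)
  ultimately have k: "(\<lambda>z. 1 / q z) holomorphic_on ball 0 1"
    by (intro holomorphic_intros) auto
  have sub: "cball 0 t \<subseteq> ball (0::complex) 1" using t by auto
  have "compact (sphere (0::complex) t)" "sphere (0::complex) t \<noteq> {}" using t by auto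
  moreover have "continuous_on (sphere 0 t) (\<lambda>z. norm (1 / q z))"
    by (rule continuous_on_norm[OF continuous_on_subset[OF holomorphic_on_imp_continuous_on[OF k]]])
      (use sub in auto)
  ultimately obtain z1 where z1: "z1 \<in> sphere 0 t" "\<And>z. z \<in> sphere 0 t \<Longrightarrow> norm (1 / q z) \<le> norm (1 / q z1)"
    using continuous_attains_sup[of "sphere 0 t" "\<lambda>z. norm (1 / q z)"] by blast
  have "norm (1 / q 0) \<le> norm (1 / q z1)"
  proof (rule maximum_modulus_frontier[of "\<lambda>z. 1 / q z" "cball 0 t" _ 0])
    show "(\<lambda>z. 1 / q z) holomorphic_on interior (cball 0 t)"
      using k sub by (meson holomorphic_on_subset interior_subset order_trans)
    show "continuous_on (closure (cball 0 t)) (\<lambda>z. 1 / q z)"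
      using holomorphic_on_imp_continuous_on[OF k] sub by (metis closed_cball closure_closed continuous_on_subset)
  qed (use z1 t in auto)
  moreover have "norm (1 / q z1) < 1"
  proof -
    have "norm z1 = t" using z1 by simp
    moreover have "norm (F z1) > t" using no calculation by force
    moreover have "z1 \<noteq> 0" using calculation t by auto
    ultimately show ?thesis using t by (simp add: q_def norm_divide divide_less_eq)
  qed
  ultimately show False by (simp add: q_def)
qed

text \<open>With \<open>a\<close> an omitted value, \<open>F (exp s) / a\<close> omits \<open>0\<close> and \<open>1\<close> on the left half-plane, so
  Schottky's theorem transports the bound at one point of a circle to the whole circle.\<close>

lemma normalized_univalent_bound:
  assumes F: "F holomorphic_on ball 0 1" "inj_on F (ball 0 1)" and F0: "F 0 = 0" "deriv F 0 = 1"
    and z: "norm z = exp (-9)"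
  shows "norm (F z) \<le> 2 * exp (pi * exp (pi * 16))"
proof -
  obtain a where a: "norm a = 2" "a \<notin> F ` ball 0 1" using normalized_univalent_omits[OF F F0] by blast
  obtain z0 where z0: "norm z0 = exp (-9)" "norm (F z0) \<le> exp (-9)"
    using normalized_univalent_min_on_sphere[OF F F0, of "exp (-9)"] by auto
  have nz: "z \<noteq> 0" "z0 \<noteq> 0" using z z0 by auto
  define s0 where "s0 = Ln z0"
  have s0: "Re s0 = -9" "exp s0 = z0" using z0 nz by (auto simp: s0_def)
  define \<xi> where "\<xi> = Ln (z / z0) / 8"
  have \<xi>: "norm \<xi> \<le> 1/2"
  proof -
    have "Re (Ln (z / z0)) = 0" using nz z z0 by (simp add: norm_divide)
    then have "norm (Ln (z / z0)) = \<bar>Im (Ln (z / z0))\<bar>" by (simp add: cmod_def)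
    also have "\<dots> \<le> pi" using Im_Ln_le_pi[of "z/z0"] mpi_less_Im_Ln[of "z/z0"] nz by auto
    finally show ?thesis using pi_less_4 by (simp add: \<xi>_def norm_divide)
  qed
  \<comment> \<open>Since \<open>Re s0 = -9\<close>, adding \<open>8 * w\<close> with
    \<open>norm w \<le> 1\<close> keeps the real part below 0, and \<open>z\<close> is reached from
    \<open>z0\<close> by an angle of at most \<open>pi\<close>, hence at
    \<open>norm \<xi> \<le> pi / 8 < 1/2\<close>. Schottky's exponent is then
    \<open>2 + 2 + 12 = 16\<close>, and the factor 2 in the bound is \<open>norm a\<close>.\<close>
  define Q where "Q w = F (exp (s0 + 8 * w)) / a" for w
  have inb: "exp (s0 + 8 * w) \<in> ball 0 1" if "w \<in> cball 0 1" for w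
  proof -
    have "Re w \<le> 1" using complex_Re_le_cmod[of w] that by simp
    then show ?thesis using s0 by simp
  qed
  have Q: "(F \<circ> (\<lambda>w. exp (s0 + 8 * w))) holomorphic_on cball 0 1"
    using inb by (intro holomorphic_on_compose_gen[OF _ F(1)] holomorphic_intros) auto
  have "norm (Q \<xi>) \<le> exp (pi * exp (pi * (2 + 2 * 1 + 12 * (1/2) / (1 - 1/2))))"
  proof (rule Schottky[of Q 1 "1/2" \<xi>])
    have "(\<lambda>w. (F \<circ> (\<lambda>w. exp (s0 + 8 * w))) w / a) holomorphic_on cball 0 1"
      using a(1) by (intro holomorphic_on_divide[OF Q] holomorphic_on_const) auto
    then show "Q holomorphic_on cball 0 1" by (simp add: Q_def[abs_def] o_def)
    have "exp (-9) \<le> (1::real)" by simp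
    then have "norm (F z0) \<le> 2" using z0(2) by linarith
    then show "norm (Q 0) \<le> 1" using z0 a(1) s0 unfolding Q_def by (simp add: norm_divide)
    fix w :: complex assume w: "w \<in> cball 0 1"
    have "F (exp (s0 + 8 * w)) \<noteq> F 0" using inj_onD[OF F(2), of "exp (s0 + 8 * w)" 0] inb[OF w] by auto
    moreover have "F (exp (s0 + 8 * w)) \<noteq> a" using a inb[OF w] by blast
    ultimately show "\<not> (Q w = 0 \<or> Q w = 1)" using F0 a(1) by (auto simp: Q_def)
  qed (use \<xi> in auto)
  moreover have "exp (s0 + 8 * \<xi>) = z" using nz s0 by (simp add: \<xi>_def exp_add)
  ultimately show ?thesis using a(1) by (simp add: Q_def norm_divide field_simps)
qed

lemma normalized_univalent_deriv:
  obtains \<kappa> :: real where "0 < \<kappa>" "\<kappa> < 1"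
    "\<And>F z. F holomorphic_on ball 0 1 \<Longrightarrow> inj_on F (ball 0 1) \<Longrightarrow> F 0 = 0 \<Longrightarrow> deriv F 0 = 1 \<Longrightarrow>
      norm z \<le> \<kappa> \<Longrightarrow> norm (deriv F z - 1) \<le> 1/2"
proof
  define B :: real where "B = 2 * exp (pi * exp (pi * 16))"
  define t :: real where "t = exp (-9)"
  have B: "B > 0" by (simp add: B_def)
  have t: "0 < t" "t < 1" by (auto simp: t_def)
  \<comment> \<open>Cauchy's estimate, passing from radius \<open>t\<close> to \<open>t/2\<close>
    and then to \<open>t/4\<close>, bounds the second derivative by \<open>8 * B / t^2\<close>;
    multiplied by \<open>\<kappa>\<close> this is at most 1/2.\<close>
  define \<kappa> where "\<kappa> = min (t/4) (t^2 / (16 * B))"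
  show "0 < \<kappa>" using t B by (simp add: \<kappa>_def)
  show "\<kappa> < 1" using t by (simp add: \<kappa>_def min_def)
  fix F :: "complex \<Rightarrow> complex" and z :: complex
  assume F: "F holomorphic_on ball 0 1" "inj_on F (ball 0 1)" "F 0 = 0" "deriv F 0 = 1" and z: "norm z \<le> \<kappa>"
  have b1t: "cball 0 t \<subseteq> ball (0::complex) 1" "cball 0 (t/2) \<subseteq> ball (0::complex) 1" using t by auto
  have F': "deriv F holomorphic_on ball 0 1" using F(1) by (intro holomorphic_deriv) auto
  have b0: "norm (F w) \<le> B" if "norm w \<le> t" for w
  proof (rule maximum_modulus_frontier[of F "cball 0 t"])
    show "F holomorphic_on interior (cball 0 t)" by (rule holomorphic_on_subset[OF F(1)]) (use t in auto)
    show "continuous_on (closure (cball 0 t)) F"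
      by (rule continuous_on_subset[OF holomorphic_on_imp_continuous_on[OF F(1)]]) (use t in auto)
    show "norm (F z) \<le> B" if "z \<in> frontier (cball 0 t)" for z
      using normalized_univalent_bound[OF F] that t by (simp add: B_def t_def)
  qed (use that in auto)
  have b1: "norm (deriv F w) \<le> 2 * B / t" if w: "norm w \<le> t/2" for w
  proof -
    have sub: "cball w (t/2) \<subseteq> cball 0 t" "ball w (t/2) \<subseteq> cball 0 t" using w by (auto simp: cball_subset_cball_iff ball_subset_cball_iff dist_norm)
    have "norm ((deriv ^^ 1) F w) \<le> fact 1 * B / (t/2) ^ 1"
    proof (rule Cauchy_inequality)
      show "F holomorphic_on ball w (t/2)"
        by (rule holomorphic_on_subset[OF F(1)]) (use sub b1t in blast)
      show "continuous_on (cball w (t/2)) F"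
        by (rule continuous_on_subset[OF holomorphic_on_imp_continuous_on[OF F(1)]]) (use sub b1t in blast)
      fix x assume "norm (w - x) = t/2"
      then have "x \<in> cball w (t/2)" by (simp add: dist_norm)
      then have "x \<in> cball 0 t" using sub by blast
      then show "norm (F x) \<le> B" by (intro b0) simp
    qed (use t in auto)
    then show ?thesis by (simp add: field_simps)
  qed
  have b2: "norm (deriv (deriv F) w) \<le> 8 * B / t^2" if w: "norm w \<le> t/4" for w
  proof -
    have sub: "cball w (t/4) \<subseteq> cball 0 (t/2)" "ball w (t/4) \<subseteq> cball 0 (t/2)" using w by (auto simp: cball_subset_cball_iff ball_subset_cball_iff dist_norm)
    have "norm ((deriv ^^ 1) (deriv F) w) \<le> fact 1 * (2 * B / t) / (t/4) ^ 1"
    proof (rule Cauchy_inequality)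
      show "deriv F holomorphic_on ball w (t/4)"
        by (rule holomorphic_on_subset[OF F']) (use sub b1t in blast)
      show "continuous_on (cball w (t/4)) (deriv F)"
        by (rule continuous_on_subset[OF holomorphic_on_imp_continuous_on[OF F']]) (use sub b1t in blast)
      fix x assume "norm (w - x) = t/4"
      then have "x \<in> cball w (t/4)" by (simp add: dist_norm)
      then have "x \<in> cball 0 (t/2)" using sub by blast
      then show "norm (deriv F x) \<le> 2 * B / t" by (intro b1) simp
    qed (use t in auto)
    then show ?thesis by (simp add: field_simps power2_eq_square)
  qed
  have "norm (deriv F z - deriv F 0) \<le> (8 * B / t^2) * norm (z - 0)"
  proof (rule field_differentiable_bound[of "cball 0 (t/4)" "deriv F" "deriv (deriv F)"])
    fix w :: complex assume "w \<in> cball 0 (t/4)"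
    then have "w \<in> ball 0 1" using t by auto
    then show "(deriv F has_field_derivative deriv (deriv F) w) (at w within cball 0 (t/4))"
      using holomorphic_derivI[OF F' open_ball] by blast
  qed (use z b2 t in \<open>auto simp: \<kappa>_def\<close>)
  also have "\<dots> \<le> (8 * B / t^2) * (t^2 / (16 * B))"
    using z B by (intro mult_left_mono) (auto simp: \<kappa>_def)
  also have "\<dots> = 1/2" using B t by (simp add: field_simps)
  finally show "norm (deriv F z - 1) \<le> 1/2" using F by simp
qed

lemma univalent_deriv_near_centre:
  obtains \<kappa> :: real where "0 < \<kappa>" "\<kappa> < 1"
    "\<And>F w \<rho> z. \<rho> > 0 \<Longrightarrow> F holomorphic_on ball w \<rho> \<Longrightarrow> inj_on F (ball w \<rho>) \<Longrightarrow> norm (z - w) \<le> \<kappa> * \<rho> \<Longrightarrow>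
      norm (deriv F z - deriv F w) \<le> norm (deriv F w) / 2"
proof -
  obtain \<kappa> :: real where \<kappa>: "0 < \<kappa>" "\<kappa> < 1"
    and D: "\<And>F z. F holomorphic_on ball 0 1 \<Longrightarrow> inj_on F (ball 0 1) \<Longrightarrow> F 0 = 0 \<Longrightarrow> deriv F 0 = 1 \<Longrightarrow>
      norm z \<le> \<kappa> \<Longrightarrow> norm (deriv F z - 1) \<le> 1/2"
    using normalized_univalent_deriv by metis
  show ?thesis
  proof (rule that[OF \<kappa>])
    fix F w and \<rho> :: real and z
    assume \<rho>: "\<rho> > 0" and F: "F holomorphic_on ball w \<rho>" "inj_on F (ball w \<rho>)" and z: "norm (z - w) \<le> \<kappa> * \<rho>"
    define d where "d = deriv F w"
    have d: "d \<noteq> 0" unfolding d_def using holomorphic_injective_imp_regular[OF F(1) open_ball F(2)] \<rho> by auto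
    define G where "G = (\<lambda>\<zeta>::complex. (F (w + \<rho> * \<zeta>) - F w) / (\<rho> * d))"
    have in_ball: "w + \<rho> * \<zeta> \<in> ball w \<rho>" if "\<zeta> \<in> ball 0 1" for \<zeta> :: complex
      using that \<rho> by (simp add: dist_norm norm_mult)
    have dG: "(G has_field_derivative deriv F (w + \<rho> * \<zeta>) / d) (at \<zeta>)" if "\<zeta> \<in> ball 0 1" for \<zeta> :: complex
    proof -
      have "(F has_field_derivative deriv F (w + \<rho> * \<zeta>)) (at (w + \<rho> * \<zeta>))"
        by (rule holomorphic_derivI[OF F(1) open_ball in_ball[OF that]])
      moreover have "((\<lambda>\<zeta>. w + \<rho> * \<zeta>) has_field_derivative of_real \<rho>) (at \<zeta>)"
        by (auto intro!: derivative_eq_intros)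
      ultimately have "((\<lambda>\<zeta>. F (w + \<rho> * \<zeta>)) has_field_derivative deriv F (w + \<rho> * \<zeta>) * \<rho>) (at \<zeta>)"
        by (rule DERIV_chain2)
      then have "(G has_field_derivative (deriv F (w + \<rho> * \<zeta>) * \<rho> - 0) / (\<rho> * d)) (at \<zeta>)"
        unfolding G_def by (intro DERIV_cdivide DERIV_diff DERIV_const)
      then show ?thesis using \<rho> d by simp
    qed
    have "norm (deriv G ((z - w) / \<rho>) - 1) \<le> 1/2"
    proof (rule D)
      show "G holomorphic_on ball 0 1" unfolding holomorphic_on_open[OF open_ball] using dG by blast
      show "inj_on G (ball 0 1)"
      proof (rule inj_onI)
        fix x y :: complex assume xy: "x \<in> ball 0 1" "y \<in> ball 0 1" "G x = G y"
        then have "F (w + \<rho> * x) = F (w + \<rho> * y)" using \<rho> d by (simp add: G_def)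
        then have "w + \<rho> * x = w + \<rho> * y" using inj_onD[OF F(2)] in_ball xy by blast
        then show "x = y" using \<rho> by simp
      qed
      show "G 0 = 0" by (simp add: G_def)
      show "deriv G 0 = 1" using DERIV_imp_deriv[OF dG[of 0]] d by (simp add: d_def)
      show "norm ((z - w) / \<rho>) \<le> \<kappa>" using z \<rho> by (simp add: norm_divide field_simps)
    qed
    moreover have "deriv G ((z - w) / \<rho>) = deriv F z / d"
    proof -
      have "(z - w) / \<rho> \<in> ball 0 1"
      proof -
        have "norm (z - w) < 1 * \<rho>" using z \<kappa> \<rho> by (intro le_less_trans[OF z] mult_strict_right_mono)
        then show ?thesis using \<rho> by (simp add: norm_divide)
      qed
      then show ?thesis using DERIV_imp_deriv[OF dG] \<rho> by simp
    qed
    ultimately have "norm (deriv F z / d - 1) * norm d \<le> 1/2 * norm d" by (intro mult_right_mono) auto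
    moreover have "norm (deriv F z / d - 1) * norm d = norm (deriv F z - d)"
      using d by (simp flip: norm_mult add: left_diff_distrib)
    ultimately show "norm (deriv F z - deriv F w) \<le> norm (deriv F w) / 2" by (simp add: d_def)
  qed
qed

text \<open>Walk from \<open>w\<close> to \<open>z\<close> in \<open>N\<close> equal steps. Every
  point of the segment is the centre of a disc of radius \<open>\<rho>/2\<close> in the domain, and
  no step is longer than \<open>\<kappa> * \<rho>/2\<close>, so each changes the modulus of the
  derivative by a factor at most 2; \<open>N\<close> depends on \<open>\<kappa>\<close>
  only.\<close>

lemma univalent_distortion:
  obtains L :: real where "L \<ge> 1"
    "\<And>F w \<rho> z. F holomorphic_on ball w \<rho> \<Longrightarrow> inj_on F (ball w \<rho>) \<Longrightarrow> z \<in> ball w (\<rho>/2) \<Longrightarrow>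
      norm (deriv F z) \<le> L * norm (deriv F w) \<and> norm (deriv F w) \<le> L * norm (deriv F z)"
proof -
  obtain \<kappa> :: real where \<kappa>: "0 < \<kappa>" "\<kappa> < 1"
    and D: "\<And>F w \<rho> z. \<rho> > 0 \<Longrightarrow> F holomorphic_on ball w \<rho> \<Longrightarrow> inj_on F (ball w \<rho>) \<Longrightarrow>
      norm (z - w) \<le> \<kappa> * \<rho> \<Longrightarrow> norm (deriv F z - deriv F w) \<le> norm (deriv F w) / 2"
    using univalent_deriv_near_centre by metis
  obtain N :: nat where N: "N > 0" "1 / N < \<kappa>"
    using \<kappa> reals_Archimedean[of \<kappa>] by (metis inverse_eq_divide zero_less_Suc)
  show ?thesis
  proof (rule that[of "2 ^ N"])
    fix F w and \<rho> :: real and z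
    assume F: "F holomorphic_on ball w \<rho>" "inj_on F (ball w \<rho>)" and z: "z \<in> ball w (\<rho>/2)"
    have z': "norm (z - w) < \<rho>/2" using z by (simp add: dist_norm norm_minus_commute)
    then have \<rho>: "\<rho> > 0" using norm_ge_zero[of "z - w"] by linarith
    define p where "p j = w + of_real (real j / N) * (z - w)" for j :: nat
    have "norm (deriv F (p j)) \<le> 2 ^ j * norm (deriv F w) \<and> norm (deriv F w) \<le> 2 ^ j * norm (deriv F (p j))"
      if "j \<le> N" for j
      using that
    proof (induction j)
      case 0
      then show ?case by (simp add: p_def)
    next
      case (Suc j)
      have "norm (p j - w) = (real j / N) * norm (z - w)" by (simp add: p_def norm_mult del: of_real_divide)
      also have "\<dots> \<le> 1 * norm (z - w)" using Suc.prems N by (intro mult_right_mono) auto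
      finally have sub: "ball (p j) (\<rho>/2) \<subseteq> ball w \<rho>" using z' \<rho> by (subst ball_subset_ball_iff) (auto simp: dist_norm)
      have "p (Suc j) - p j = of_real (1 / N) * (z - w)"
        by (simp add: p_def algebra_simps add_divide_distrib)
      then have "norm (p (Suc j) - p j) = (1 / N) * norm (z - w)"
        by (simp add: norm_mult norm_divide)
      also have "\<dots> \<le> \<kappa> * (\<rho>/2)" using N z' \<kappa> by (intro mult_mono) auto
      finally have "norm (deriv F (p (Suc j)) - deriv F (p j)) \<le> norm (deriv F (p j)) / 2"
        using \<rho> sub F by (intro D[of "\<rho>/2"]) (auto intro: holomorphic_on_subset inj_on_subset)
      then have *: "norm (deriv F (p (Suc j))) \<le> 2 * norm (deriv F (p j))"
          "norm (deriv F (p j)) \<le> 2 * norm (deriv F (p (Suc j)))"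
        using norm_triangle_ineq2[of "deriv F (p (Suc j))" "deriv F (p j)"]
          norm_triangle_ineq3[of "deriv F (p (Suc j))" "deriv F (p j)"] norm_ge_zero[of "deriv F (p j)"]
        by linarith+
      have IH: "norm (deriv F (p j)) \<le> 2 ^ j * norm (deriv F w)" "norm (deriv F w) \<le> 2 ^ j * norm (deriv F (p j))"
        using Suc by auto
      have "2 ^ j * norm (deriv F (p j)) \<le> 2 ^ j * (2 * norm (deriv F (p (Suc j))))"
        using * by (intro mult_left_mono) auto
      then have "norm (deriv F w) \<le> 2 ^ j * (2 * norm (deriv F (p (Suc j))))" using IH(2) by linarith
      moreover have "norm (deriv F (p (Suc j))) \<le> 2 * (2 ^ j * norm (deriv F w))" using *(1) IH(1) by linarith
      ultimately show ?case by (simp add: mult_ac)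
    qed
    from this[of N] have "norm (deriv F (p N)) \<le> 2 ^ N * norm (deriv F w) \<and> norm (deriv F w) \<le> 2 ^ N * norm (deriv F (p N))"
      by simp
    moreover have "p N = z" using N by (simp add: p_def)
    ultimately show "norm (deriv F z) \<le> 2 ^ N * norm (deriv F w) \<and> norm (deriv F w) \<le> 2 ^ N * norm (deriv F z)"
      by simp
  qed simp
qed

section \<open>Vitali covering and the area of injective images\<close>

lemma content_ball_complex: "r \<ge> 0 \<Longrightarrow> measure lebesgue (ball (c::complex) r) = pi * r\<^sup>2"
  by (simp add: content_ball unit_ball_vol_2)

text \<open>Passing to a finite subcover makes the radii bounded, as Vitali's lemma demands; its
  fivefold enlargement accounts for the factor \<open>25 = 5^2\<close>.\<close>

lemma Vitali_compact:
  fixes K :: "complex set"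
  assumes K: "compact K" and r: "\<And>x. x \<in> K \<Longrightarrow> 0 < r x"
  obtains C where "finite C" "C \<subseteq> K" "pairwise (\<lambda>x y. disjnt (ball x (r x)) (ball y (r y))) C"
    "measure lebesgue K \<le> 25 * pi * (\<Sum>x\<in>C. (r x)\<^sup>2)"
proof -
  obtain D where D: "D \<subseteq> K" "finite D" "K \<subseteq> (\<Union>x\<in>D. ball x (r x))"
  proof (rule compactE_image[OF K, of K "\<lambda>x. ball x (r x)"])
    show "K \<subseteq> (\<Union>x\<in>K. ball x (r x))" using r by force
  qed auto
  have bd: "0 < r x \<and> r x \<le> (\<Sum>y\<in>D. r y)" if "x \<in> D" for x
  proof
    show "0 < r x" using that D r by blast
    show "r x \<le> sum r D" using that D r by (intro member_le_sum) (auto intro: less_imp_le)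
  qed
  obtain C where "countable C" and C: "C \<subseteq> D" "pairwise (\<lambda>x y. disjnt (ball x (r x)) (ball y (r y))) C"
    "K \<subseteq> (\<Union>x\<in>C. ball x (5 * r x))"
    by (rule Vitali_covering_lemma_balls[OF D(3) bd])
  have fin: "finite C" by (rule finite_subset[OF C(1) D(2)])
  have "measure lebesgue K \<le> measure lebesgue (\<Union>x\<in>C. ball x (5 * r x))"
    using C(3) K fin by (intro measure_mono_fmeasurable) (auto intro: lmeasurable_compact fmeasurableD fmeasurable.finite_UN)
  also have "\<dots> \<le> (\<Sum>x\<in>C. measure lebesgue (ball x (5 * r x)))"
    using fin by (intro measure_UNION_le) auto
  also have "\<dots> = (\<Sum>x\<in>C. 25 * pi * (r x)\<^sup>2)"
  proof (rule sum.cong)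
    fix x assume "x \<in> C"
    then have "0 < r x" using C D r by blast
    then show "measure lebesgue (ball x (5 * r x)) = 25 * pi * (r x)\<^sup>2"
      by (subst content_ball_complex) (auto simp: power2_eq_square)
  qed simp
  also have "\<dots> = 25 * pi * (\<Sum>x\<in>C. (r x)\<^sup>2)" by (simp add: sum_distrib_left)
  finally show ?thesis using that[OF fin] C(1,2) D(1) by blast
qed

text \<open>On a small disc about \<open>y\<close> the derivative has at most twice its modulus at
  \<open>y\<close>, so Bloch's lemma puts a disc of radius at least \<open>17/100 * r * m\<close>
  into the image. Vitali's lemma selects disjoint discs, and injectivity keeps their images
  disjoint; adding up areas gives the change-of-variables inequality up to a constant.\<close>

lemma injective_image_area:
  assumes F: "F holomorphic_on Y" "inj_on F Y" and Y: "open Y" "bounded Y" and b: "bounded (F ` Y)"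
    and m: "m > 0" "\<And>y. y \<in> Y \<Longrightarrow> m \<le> norm (deriv F y)"
  shows "measure lebesgue Y * m\<^sup>2 \<le> 2000 * measure lebesgue (F ` Y)"
proof -
  have Ym: "Y \<in> lmeasurable" using Y by (simp add: lmeasurable_open)
  have "open (F ` Y)" by (rule open_mapping_thm3[OF F(1) Y(1) F(2)])
  then have FYm: "F ` Y \<in> lmeasurable" using b by (simp add: lmeasurable_open)
  have sq: "17/100 \<le> 3 - 2 * sqrt (2::real)"
  proof -
    have "sqrt 2 \<le> sqrt ((1415/1000)^2)" by (subst real_sqrt_le_iff) (simp add: power2_eq_square)
    then show ?thesis by simp
  qed
  have ex: "\<exists>r>0. cball y r \<subseteq> Y \<and> ball (F y) (17/100 * r * m) \<subseteq> F ` ball y r" if y: "y \<in> Y" for y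
  proof -
    have cont: "continuous_on Y (deriv F)"
      using F(1) Y(1) by (intro holomorphic_on_imp_continuous_on holomorphic_deriv)
    have "open (Y \<inter> deriv F -` ball 0 (2 * norm (deriv F y)))"
      using cont Y(1) by (intro continuous_open_preimage) auto
    moreover have "0 < norm (deriv F y)" using m y by (meson less_le_trans)
    then have "y \<in> Y \<inter> deriv F -` ball 0 (2 * norm (deriv F y))" using y by simp
    ultimately obtain r where r: "r > 0" "cball y r \<subseteq> Y \<inter> deriv F -` ball 0 (2 * norm (deriv F y))"
      using open_contains_cball by metis
    have "ball (F y) ((3 - 2 * sqrt 2) * r * norm (deriv F y)) \<subseteq> F ` ball y r"
    proof (rule Bloch_lemma)
      show "F holomorphic_on cball y r" using F(1) r(2) holomorphic_on_subset by blast
      fix z assume "z \<in> ball y r"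
      then have "z \<in> cball y r" by simp
      then show "norm (deriv F z) \<le> 2 * norm (deriv F y)" using r(2) by (auto dest!: subsetD)
    qed (use r in auto)
    moreover have "17/100 * r * m \<le> (3 - 2 * sqrt 2) * r * norm (deriv F y)"
      using sq r m y by (intro mult_mono) auto
    ultimately show ?thesis using r subset_ball by (meson le_inf_iff order_trans)
  qed
  then obtain r where r: "\<And>y. y \<in> Y \<Longrightarrow> r y > 0 \<and> cball y (r y) \<subseteq> Y \<and>
      ball (F y) (17/100 * r y * m) \<subseteq> F ` ball y (r y)"
    by metis
  \<comment> \<open>Vitali's factor 25 divided by \<open>(17/100)^2\<close> is below 1000; the final
    2000 comes from replacing \<open>Y\<close> by a compact subset with at least half its
    area.\<close>
  have K: "measure lebesgue K * m\<^sup>2 \<le> 1000 * measure lebesgue (F ` Y)" if K: "compact K" "K \<subseteq> Y" for K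
  proof -
    obtain C where C: "finite C" "C \<subseteq> K" "pairwise (\<lambda>x y. disjnt (ball x (r x)) (ball y (r y))) C"
      "measure lebesgue K \<le> 25 * pi * (\<Sum>x\<in>C. (r x)\<^sup>2)"
      using Vitali_compact[OF K(1), of r] r K(2) by blast
    have CY: "C \<subseteq> Y" using C that by blast
    define D where "D x = ball (F x) (17/100 * r x * m)" for x
    have disj: "pairwise (\<lambda>x y. disjnt (D x) (D y)) C"
    proof (rule pairwiseI)
      fix x y assume xy: "x \<in> C" "y \<in> C" "x \<noteq> y"
      have "ball x (r x) \<inter> ball y (r y) = {}" using C(3) xy by (auto simp: pairwise_def disjnt_def)
      moreover have "ball x (r x) \<subseteq> Y" "ball y (r y) \<subseteq> Y" using r CY xy by (meson ball_subset_cball order_trans subsetD)+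
      ultimately have "F ` ball x (r x) \<inter> F ` ball y (r y) = {}"
        using F(2) by (metis image_empty inj_on_image_Int)
      moreover have "D x \<subseteq> F ` ball x (r x)" "D y \<subseteq> F ` ball y (r y)"
        unfolding D_def using r CY xy(1,2) by (meson subsetD)+
      ultimately show "disjnt (D x) (D y)" unfolding disjnt_def by blast
    qed
    have "(\<Sum>x\<in>C. pi * (17/100 * r x * m)\<^sup>2) = (\<Sum>x\<in>C. measure lebesgue (D x))"
    proof (rule sum.cong)
      fix x assume "x \<in> C"
      then have "17/100 * r x * m \<ge> 0" using r CY m by (simp add: subset_iff less_imp_le)
      then show "pi * (17/100 * r x * m)\<^sup>2 = measure lebesgue (D x)"
        unfolding D_def by (rule content_ball_complex[symmetric])
    qed simp
    also have "\<dots> = measure lebesgue (\<Union>x\<in>C. D x)"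
      using C(1) disj by (intro measure_UNION'[symmetric]) (auto simp: D_def)
    also have "\<dots> \<le> measure lebesgue (F ` Y)"
    proof (rule measure_mono_fmeasurable)
      have "D x \<subseteq> F ` Y" if "x \<in> C" for x
      proof -
        have "x \<in> Y" using CY that by blast
        then have "D x \<subseteq> F ` ball x (r x)" "ball x (r x) \<subseteq> Y"
          unfolding D_def using r ball_subset_cball by (meson order_trans)+
        then show ?thesis by blast
      qed
      then show "(\<Union>x\<in>C. D x) \<subseteq> F ` Y" by blast
    qed (use FYm C in \<open>auto simp: D_def\<close>)
    finally have *: "(\<Sum>x\<in>C. pi * (17/100 * r x * m)\<^sup>2) \<le> measure lebesgue (F ` Y)" .
    define X where "X = pi * m\<^sup>2 * (\<Sum>x\<in>C. (r x)\<^sup>2)"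
    have "(\<Sum>x\<in>C. pi * (17/100 * r x * m)\<^sup>2) = 289/10000 * X"
      unfolding X_def sum_distrib_left by (intro sum.cong) (simp_all add: power2_eq_square)
    moreover have "measure lebesgue K * m\<^sup>2 \<le> (25 * pi * (\<Sum>x\<in>C. (r x)\<^sup>2)) * m\<^sup>2"
      using C(4) by (intro mult_right_mono) auto
    then have "measure lebesgue K * m\<^sup>2 \<le> 25 * X" by (simp add: X_def mult_ac)
    moreover have "0 \<le> X" unfolding X_def by (intro mult_nonneg_nonneg sum_nonneg) auto
    ultimately show ?thesis using * by linarith
  qed
  show ?thesis
  proof (rule ccontr)
    assume no: "\<not> ?thesis"
    have "2000 * measure lebesgue (F ` Y) \<ge> 0" by simp
    then have pos: "measure lebesgue Y > 0" using no m by (smt (verit) measure_nonneg mult_eq_0_iff)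
    obtain T where T: "closed T" "T \<subseteq> Y" "Y - T \<in> lmeasurable" "emeasure lebesgue (Y - T) < ennreal (measure lebesgue Y / 2)"
      using sets_lebesgue_inner_closed[of Y "measure lebesgue Y / 2"] Ym pos by (auto simp: fmeasurableD)
    have cT: "compact T" using T Y bounded_subset compact_eq_bounded_closed by blast
    have "measure lebesgue (Y - T) < measure lebesgue Y / 2"
      using T(3,4) pos by (simp add: emeasure_eq_measure2 ennreal_less_iff)
    moreover have "measure lebesgue (Y - T) = measure lebesgue Y - measure lebesgue T"
      using Ym cT T(2) by (intro measurable_measure_Diff) (auto intro: lmeasurable_compact fmeasurableD)
    ultimately have "measure lebesgue Y \<le> 2 * measure lebesgue T" by simp
    then have "measure lebesgue Y * m\<^sup>2 \<le> 2 * measure lebesgue T * m\<^sup>2" by (intro mult_right_mono) auto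
    then show False using K[OF cT T(2)] no by simp
  qed
qed

subsection \<open>The area of the preimage of a disc\<close>

lemma measurable_Complex_pair:
  "(\<lambda>(x, y). Complex x y) \<in> (lborel \<Otimes>\<^sub>M lborel) \<rightarrow>\<^sub>M borel"
proof -
  have cont: "continuous_on UNIV (\<lambda>(x, y). Complex x y)"
    unfolding split_def Complex_eq by (intro continuous_intros)
  show ?thesis
    using borel_measurable_continuous_onI[OF cont] by (simp add: borel_prod measurable_cong_sets[OF sets_pair_measure_cong[OF sets_lborel sets_lborel] refl])
qed

lemma lborel_complex_eq_distr:
  "(lborel :: complex measure) = distr (lborel \<Otimes>\<^sub>M lborel) borel (\<lambda>(x, y). Complex x y)"
proof (rule lborel_eqI)
  note meas = measurable_Complex_pair
  fix l u :: complex assume le: "\<And>b. b \<in> Basis \<Longrightarrow> l \<bullet> b \<le> u \<bullet> b"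
  have le': "Re l \<le> Re u" "Im l \<le> Im u"
    using le[of 1] le[of \<i>] by (auto simp: Basis_complex_def)
  have "(\<lambda>(x, y). Complex x y) -` box l u \<inter> space (lborel \<Otimes>\<^sub>M lborel) = box (Re l) (Re u) \<times> box (Im l) (Im u)"
    by (auto simp: box_def Basis_complex_def space_pair_measure)
  then have "emeasure (distr (lborel \<Otimes>\<^sub>M lborel) borel (\<lambda>(x, y). Complex x y)) (box l u)
      = emeasure (lborel \<Otimes>\<^sub>M lborel) (box (Re l) (Re u) \<times> box (Im l) (Im u))"
    using meas by (subst emeasure_distr) auto
  also have "\<dots> = ennreal (Re u - Re l) * ennreal (Im u - Im l)"
    using le' by (subst lborel.emeasure_pair_measure_Times) (auto simp: box_real)
  also have "\<dots> = ennreal (\<Prod>b\<in>Basis. (u - l) \<bullet> b)"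
    using le' by (simp add: Basis_complex_def ennreal_mult' prod.insert)
  finally show "emeasure (distr (lborel \<Otimes>\<^sub>M lborel) borel (\<lambda>(x, y). Complex x y)) (box l u)
      = ennreal (\<Prod>b\<in>Basis. (u - l) \<bullet> b)" .
qed simp

lemma emeasure_complex_slices:
  assumes U: "U \<in> sets borel"
  shows "emeasure lborel U = (\<integral>\<^sup>+x. emeasure lborel {y. Complex x y \<in> U} \<partial>lborel)"
proof -
  note meas = measurable_Complex_pair
  define V where "V = (\<lambda>(x, y). Complex x y) -` U \<inter> space (lborel \<Otimes>\<^sub>M lborel)"
  have V: "V \<in> sets (lborel \<Otimes>\<^sub>M lborel)" unfolding V_def using meas U by (rule measurable_sets)
  have "emeasure lborel U = emeasure (lborel \<Otimes>\<^sub>M lborel) V"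
    unfolding V_def by (subst lborel_complex_eq_distr) (rule emeasure_distr[OF meas U])
  also have "\<dots> = (\<integral>\<^sup>+x. emeasure lborel (Pair x -` V) \<partial>lborel)"
    by (rule lborel.emeasure_pair_measure_alt[OF V])
  also have "(\<lambda>x. Pair x -` V) = (\<lambda>x. {y. Complex x y \<in> U})"
    by (auto simp: V_def space_pair_measure fun_eq_iff)
  finally show ?thesis .
qed

text \<open>Wherever it lies, an interval of length at least \<open>2 * pi * (m + 1)\<close>
  contains \<open>m\<close> consecutive cells \<open>[2 \<pi> j, 2 \<pi> (j+1))\<close>; one period
  is lost to alignment.\<close>

lemma periodic_measure_ge:
  fixes P :: "real \<Rightarrow> bool"
  assumes P: "open {y. P y}" and per: "\<And>y. P (y + 2 * pi) = P y" and len: "2 * pi * (real m + 1) \<le> b - a"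
  shows "real m * measure lborel {t \<in> {0..2*pi}. P t} \<le> measure lborel {y \<in> {a<..<b}. P y}"
proof -
  have per': "P (y + 2 * pi * of_int n) = P y" for y and n :: int
  proof -
    have nat: "P (y + 2 * pi * real k) = P y" for y k
    proof (induction k)
      case (Suc k)
      then show ?case using per[of "y + 2 * pi * real k"] by (simp add: algebra_simps)
    qed simp
    show ?thesis
    proof (cases "n \<ge> 0")
      case True
      then show ?thesis using nat[of y "nat n"] by simp
    next
      case False
      then show ?thesis using nat[of "y + 2 * pi * of_int n" "nat (- n)"] by simp
    qed
  qed
  define k where "k = \<lfloor>a / (2 * pi)\<rfloor> + 1"
  have "a / (2 * pi) < of_int k" "of_int k \<le> a / (2 * pi) + 1" unfolding k_def by linarith+
  then have k: "a < 2 * pi * of_int k" "2 * pi * of_int k \<le> a + 2 * pi"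
    by (simp_all add: field_simps)
  define T where "T j = {y \<in> {2 * pi * of_int j ..< 2 * pi * of_int (j + 1)}. P y}" for j :: int
  have borelP: "{y. P y} \<in> sets borel" using P by simp
  have Tm: "T j \<in> lmeasurable" for j
  proof -
    have "T j = {2 * pi * of_int j ..< 2 * pi * of_int (j + 1)} \<inter> {y. P y}" by (auto simp: T_def)
    moreover have "{2 * pi * of_int j ..< 2 * pi * of_int (j + 1)} \<inter> {y. P y} \<in> sets lebesgue"
      using borelP by (intro sets.Int) auto
    moreover have "bounded (T j)" by (rule bounded_subset[OF bounded_closed_interval[of "2 * pi * of_int j" "2 * pi * of_int (j + 1)"]]) (auto simp: T_def)
    ultimately show ?thesis by (intro bounded_set_imp_lmeasurable) auto
  qed
  have shift: "T j = (+) (2 * pi * of_int j) ` T 0" for j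
  proof
    show "(+) (2 * pi * of_int j) ` T 0 \<subseteq> T j"
      using per'[of _ j] by (auto simp: T_def algebra_simps)
    show "T j \<subseteq> (+) (2 * pi * of_int j) ` T 0"
    proof
      fix y assume "y \<in> T j"
      then have "y - 2 * pi * of_int j \<in> T 0" using per'[of "y - 2 * pi * of_int j" j] by (auto simp: T_def algebra_simps)
      moreover have "y = 2 * pi * of_int j + (y - 2 * pi * of_int j)" by simp
      ultimately show "y \<in> (+) (2 * pi * of_int j) ` T 0" by blast
    qed
  qed
  have eqm: "measure lebesgue (T j) = measure lebesgue (T 0)" for j
    by (subst shift) (rule measure_translation)
  have "{t \<in> {0..2*pi}. P t} = {0..2*pi} \<inter> {y. P y}" "{y \<in> {a<..<b}. P y} = {a<..<b} \<inter> {y. P y}" by auto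
  then have lb: "{t \<in> {0..2*pi}. P t} \<in> sets borel" "{y \<in> {a<..<b}. P y} \<in> sets borel"
    using borelP by auto
  have theta: "measure lborel {t \<in> {0..2*pi}. P t} = measure lebesgue (T 0)"
  proof -
    have "measure lebesgue {t \<in> {0..2*pi}. P t} = measure lebesgue (T 0)"
      by (rule measure_negligible_symdiff)
        (use Tm[of 0] in \<open>auto simp: T_def intro!: negligible_subset[OF negligible_sing[of "2*pi"]]\<close>)
    then show ?thesis using lb by simp
  qed
  have "real m * measure lebesgue (T 0) = (\<Sum>j\<in>{0..<int m}. measure lebesgue (T (k + j)))"
    by (simp add: eqm[of "k + _"])
  also have "\<dots> = measure lebesgue (\<Union>j\<in>{0..<int m}. T (k + j))"
  proof (rule measure_UNION'[symmetric])
    show "pairwise (\<lambda>i j. disjnt (T (k + i)) (T (k + j))) {0..<int m}"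
    proof (rule pairwiseI)
      fix i j :: int assume "i \<noteq> j"
      have "\<not> (y \<in> T (k + i) \<and> y \<in> T (k + j))" for y
      proof
        assume y: "y \<in> T (k + i) \<and> y \<in> T (k + j)"
        have fl: "\<lfloor>y / (2 * pi)\<rfloor> = l" if "y \<in> T l" for l
          using that by (intro floor_unique) (auto simp: T_def field_simps)
        then show False using y \<open>i \<noteq> j\<close> by (metis add_left_cancel)
      qed
      then show "disjnt (T (k + i)) (T (k + j))" by (auto simp: disjnt_def)
    qed
  qed (use Tm in auto)
  also have "\<dots> \<le> measure lebesgue {y \<in> {a<..<b}. P y}"
  proof (rule measure_mono_fmeasurable)
    show "(\<Union>j\<in>{0..<int m}. T (k + j)) \<subseteq> {y \<in> {a<..<b}. P y}"
    proof
      fix y assume "y \<in> (\<Union>j\<in>{0..<int m}. T (k + j))"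
      then obtain j where j: "0 \<le> j" "j < int m" "y \<in> T (k + j)" by auto
      have "2 * pi * of_int k \<le> 2 * pi * of_int (k + j)" using j by (intro mult_left_mono) auto
      moreover have "2 * pi * of_int (k + j + 1) \<le> 2 * pi * (of_int k + real m)"
        using j by (intro mult_left_mono) auto
      moreover have "2 * pi * of_int (k + j) \<le> y" "y < 2 * pi * of_int (k + j + 1)" using j by (auto simp: T_def)
      moreover have "2 * pi * (of_int k + real m) = 2 * pi * of_int k + 2 * pi * real m"
        "2 * pi * (real m + 1) = 2 * pi * real m + 2 * pi" by (simp_all add: algebra_simps)
      ultimately have "a < y" "y < b" using k len by linarith+
      then show "y \<in> {y \<in> {a<..<b}. P y}" using j by (auto simp: T_def)
    qed
    have "bounded {y \<in> {a<..<b}. P y}" by (rule bounded_subset[OF bounded_closed_interval[of a b]]) auto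
    then show "{y \<in> {a<..<b}. P y} \<in> lmeasurable" using lb by (intro bounded_set_imp_lmeasurable) auto
  qed (use Tm in auto)
  finally show ?thesis using lb theta by simp
qed

text \<open>In logarithmic coordinates the integral of \<open>\<theta>(t)/t\<close> over \<open>[r^c, r]\<close> is the area, per period,
  of the set where \<open>|f \<circ> exp| < r\<^sub>0\<close>. With \<open>r = exp (9x/8)\<close> and \<open>c \<ge> 63/65\<close> the strip
  \<open>[c \<cdot> 9x/8, 9x/8]\<close> lies within \<open>x/8\<close> of \<open>x\<close>.\<close>

lemma area_ge_theta_integral:
  fixes f :: "complex \<Rightarrow> complex"
  assumes cont: "continuous_on UNIV f" and c: "63/65 \<le> c" "c < 1" and x: "Re v = x" "32 * pi \<le> x"
    and a: "a > 0"
    and int: "1 / ln r * interval_lebesgue_integral lborel (ereal (r powr c)) (ereal r) (\<lambda>t. theta f r0 t / t) \<ge> 1 / a"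
    and r: "r = exp (9 * x / 8)"
  shows "x\<^sup>2 / (16 * pi * a) \<le> measure lebesgue {u \<in> ball v (x/4). norm (f (exp u)) < r0}"
proof -
  define X where "X = 9 * x / 8"
  have x0: "x > 0" using x(2) pi_gt_zero by linarith
  have X: "X > 0" "ln r = X" "r powr c = exp (c * X)" "r = exp X" using x0 r by (auto simp: X_def powr_def)
  have cX: "7 * x / 8 \<le> c * X" "c * X < X"
  proof -
    have "63/65 * X \<le> c * X" using c X by (intro mult_right_mono) auto
    then show "7 * x / 8 \<le> c * X" using x0 by (simp add: X_def)
    show "c * X < X" using c X by simp
  qed
  define \<theta> where "\<theta> = theta f r0"
  have \<theta>0: "\<theta> t \<ge> 0" for t by (simp add: \<theta>_def theta_def)
  define J where "J = interval_lebesgue_integral lborel (ereal (r powr c)) (ereal r) (\<lambda>t. \<theta> t / t)"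
  define F where "F t = indicator {exp (c * X)<..<exp X} t * (\<theta> t / t)" for t :: real
  have Jeq: "J = (LINT t|lborel. F t)"
    unfolding J_def F_def interval_lebesgue_integral_def set_lebesgue_integral_def
    using cX X by simp
  have Jge: "X / a \<le> J" using int X a by (simp add: J_def \<theta>_def field_simps)
  then have Jpos: "J > 0" using X a by (smt (verit) divide_pos_pos)
  \<comment> \<open>A non-integrable function has integral 0 by convention, so a positive value
    shows integrability.\<close>
  then have Fint: "integrable lborel F" using Jeq not_integrable_integral_eq by force
  have F0: "F t \<ge> 0" for t
  proof (cases "t \<in> {exp (c * X)<..<exp X}")
    case True
    then have "t > 0" using exp_gt_zero[of "c * X"] by (simp del: exp_gt_zero)
    then show ?thesis using \<theta>0 by (simp add: F_def)
  qed (simp add: F_def)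
  have "ennreal J = (\<integral>\<^sup>+t. ennreal (F t) \<partial>lborel)"
    unfolding Jeq using Fint F0 by (intro nn_integral_eq_integral[symmetric]) auto
  also have "\<dots> = (\<integral>\<^sup>+t. ennreal (F t * indicator {exp (c * X)..exp X} t) \<partial>lborel)"
    by (intro nn_integral_cong arg_cong[where f = ennreal]) (auto simp: F_def indicator_def)
  also have "\<dots> = (\<integral>\<^sup>+s. ennreal (F (exp s) * exp s * indicator {c * X..X} s) \<partial>lborel)"
  proof -
    have "F \<in> borel_measurable borel" using Fint by auto
    then have "set_borel_measurable borel {exp (c * X)..exp X} F"
      unfolding set_borel_measurable_def by measurable
    then show ?thesis using cX
      by (intro nn_integral_substitution) (auto intro!: derivative_eq_intros continuous_intros)
  qed
  finally have J_eq: "ennreal J = (\<integral>\<^sup>+s. ennreal (F (exp s) * exp s * indicator {c * X..X} s) \<partial>lborel)" .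
  have g_le: "ennreal (F (exp s) * exp s * indicator {c * X..X} s) \<le> ennreal (\<theta> (exp s)) * indicator {c * X<..<X} s" for s
    by (auto simp: F_def indicator_def)
  \<comment> \<open>Whole periods in a vertical interval of length \<open>x / 4\<close>, less one
    for alignment; \<open>x \<ge> 32 * pi\<close> makes this at least half of
    \<open>x / (8 * pi)\<close>.\<close>
  define m where "m = nat \<lfloor>x / (8 * pi)\<rfloor> - 1"
  have m: "2 * pi * (real m + 1) \<le> x / 4" "x / (16 * pi) \<le> real m"
  proof -
    have ge: "x / (8 * pi) \<ge> 4" using x by (simp add: field_simps)
    then have "real m = of_int \<lfloor>x / (8 * pi)\<rfloor> - 1" unfolding m_def by linarith
    then have "real m + 1 \<le> x / (8 * pi)" "x / (8 * pi) - 2 \<le> real m" by linarith+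
    moreover have "x / (16 * pi) = x / (8 * pi) / 2" by simp
    ultimately show "x / (16 * pi) \<le> real m" using ge by linarith
    show "2 * pi * (real m + 1) \<le> x / 4" using \<open>real m + 1 \<le> _\<close> by (simp add: field_simps)
  qed
  define U where "U = {u \<in> ball v (x/4). norm (f (exp u)) < r0}"
  have "open (ball v (x/4) \<inter> (\<lambda>u. norm (f (exp u))) -` {..<r0})"
    by (intro open_Int open_ball open_vimage open_lessThan continuous_intros continuous_on_compose2[OF cont]) auto
  moreover have "ball v (x/4) \<inter> (\<lambda>u. norm (f (exp u))) -` {..<r0} = U" by (auto simp: U_def)
  ultimately have openU: "open U" by simp
  have bU: "bounded U" by (rule bounded_subset[OF bounded_ball[of v "x/4"]]) (auto simp: U_def)
  have slice: "ennreal (real m) * (ennreal (\<theta> (exp s)) * indicator {c * X<..<X} s) \<le> emeasure lborel {y. Complex s y \<in> U}" for s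
  proof (cases "s \<in> {c * X<..<X}")
    case True
    define P where "P y \<longleftrightarrow> norm (f (exp (Complex s y))) < r0" for y
    have e: "exp (Complex s y) = of_real (exp s) * exp (\<i> * of_real y)" for y
      by (simp add: Complex_eq exp_add exp_of_real)
    have "continuous_on UNIV (\<lambda>y. norm (f (exp (Complex s y))))"
      unfolding e by (intro continuous_intros continuous_on_compose2[OF cont]) auto
    then have Popen: "open {y. P y}" unfolding P_def by (rule open_Collect_less) (intro continuous_intros)
    have per: "P (y + 2 * pi) = P y" for y
    proof -
      have "exp (\<i> * of_real (y + 2 * pi)) = exp (\<i> * of_real y)"
        using exp_plus_2pin[of "\<i> * of_real y" 1] by (simp add: algebra_simps)
      then show ?thesis by (simp add: P_def e)
    qed
    have "\<theta> (exp s) = measure lborel {t \<in> {0..2*pi}. P t}" by (simp add: \<theta>_def theta_def P_def e)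
    then have "real m * \<theta> (exp s) \<le> measure lborel {y \<in> {Im v - x/8<..<Im v + x/8}. P y}"
      using periodic_measure_ge[OF Popen per, of m "Im v + x/8" "Im v - x/8"] m by simp
    moreover have "{y \<in> {Im v - x/8<..<Im v + x/8}. P y} = {Im v - x/8<..<Im v + x/8} \<inter> {y. P y}" by auto
    moreover have "emeasure lborel ({Im v - x/8<..<Im v + x/8} \<inter> {y. P y}) \<noteq> \<infinity>"
      using emeasure_mono[of "{Im v - x/8<..<Im v + x/8} \<inter> {y. P y}" "{Im v - x/8<..<Im v + x/8}" lborel] x0
      by (auto simp: top_unique)
    ultimately have "ennreal (real m * \<theta> (exp s)) \<le> emeasure lborel {y \<in> {Im v - x/8<..<Im v + x/8}. P y}"
      by (simp add: emeasure_eq_ennreal_measure ennreal_leI)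
    also have "\<dots> \<le> emeasure lborel {y. Complex s y \<in> U}"
    proof (rule emeasure_mono)
      have "{y. Complex s y \<in> U} = (\<lambda>y. Complex s y) -` U" by auto
      moreover have "continuous_on UNIV (\<lambda>y. Complex s y)" unfolding Complex_eq by (intro continuous_intros)
      ultimately have "open {y. Complex s y \<in> U}" using openU by (simp add: open_vimage)
      then show "{y. Complex s y \<in> U} \<in> sets lborel" by (simp add: borel_open)
      show "{y \<in> {Im v - x/8<..<Im v + x/8}. P y} \<subseteq> {y. Complex s y \<in> U}"
      proof
        fix y assume y: "y \<in> {y \<in> {Im v - x/8<..<Im v + x/8}. P y}"
        have "\<bar>Re v - s\<bar> < x/8" 
        using True cX(1) x(1) unfolding X_def abs_less_iff by simp
        moreover have "\<bar>Im v - y\<bar> < x/8" using y unfolding abs_less_iff by simp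
        \<comment> \<open>The square of half-side \<open>x/8\<close> about \<open>v\<close> lies in
          the disc of radius \<open>x/4\<close>, since the modulus is at most the sum of the moduli
          of real and imaginary part.\<close>
        ultimately have "norm (v - Complex s y) < x/4"
          using cmod_le[of "v - Complex s y"] by simp
        then show "y \<in> {y. Complex s y \<in> U}" using y by (simp add: U_def P_def dist_norm)
      qed
    qed
    finally show ?thesis using True by (simp add: ennreal_mult' \<theta>0)
  qed simp
  have [measurable]: "F \<in> borel_measurable borel" using Fint by auto
  have "(\<lambda>s. ennreal (F (exp s) * exp s * indicator {c * X..X} s)) \<in> borel_measurable borel" by measurable
  then have "ennreal (real m) * ennreal J =
      (\<integral>\<^sup>+s. ennreal (real m) * ennreal (F (exp s) * exp s * indicator {c * X..X} s) \<partial>lborel)"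
    unfolding J_eq by (intro nn_integral_cmult[symmetric]) simp
  also have "\<dots> \<le> (\<integral>\<^sup>+s. emeasure lborel {y. Complex s y \<in> U} \<partial>lborel)"
    by (intro nn_integral_mono order_trans[OF mult_left_mono[OF g_le] slice]) auto
  also have "\<dots> = emeasure lborel U" using openU by (intro emeasure_complex_slices[symmetric]) auto
  also have "\<dots> = ennreal (measure lebesgue U)"
  proof -
    have "emeasure lborel U = ennreal (measure lborel U)"
      using emeasure_bounded_finite[OF bU] by (intro emeasure_eq_ennreal_measure) simp
    then show ?thesis using openU by simp
  qed
  finally have "real m * J \<le> measure lebesgue U"
    using Jpos by (simp flip: ennreal_mult')
  moreover have "x / (16 * pi) * (x / a) \<le> real m * J"
  proof (intro mult_mono)
    have "x / a \<le> X / a" using x0 a by (intro divide_right_mono) (auto simp: X_def)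
    then show "x / a \<le> J" using Jge by simp
  qed (use m x0 a in auto)
  ultimately show ?thesis by (simp add: U_def power2_eq_square)
qed

section \<open>Null sets under preimages of entire functions\<close>

lemma negligible_vimage_holomorphic:
  assumes f: "f holomorphic_on UNIV" "\<not> f constant_on UNIV" and S: "negligible S"
  shows "negligible (f -` S)"
proof -
  define Z where "Z = {z. deriv f z = 0}"
  have Z: "countable Z"
  proof (cases "deriv f constant_on UNIV")
    case True
    have "Z = {}"
    proof (rule ccontr)
      assume "Z \<noteq> {}"
      then have "deriv f z = 0" for z using True by (auto simp: Z_def constant_on_def)
      then have "(f has_field_derivative 0) (at z)" for z
        using holomorphic_derivI[OF f(1) open_UNIV, of z] by simp
      then have "\<exists>c. \<forall>z\<in>UNIV. f z = c"
        by (intro has_field_derivative_zero_constant) auto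
      then show False using f(2) by (auto simp: constant_on_def)
    qed
    then show ?thesis by simp
  next
    case False
    have "countable {z \<in> UNIV. deriv f z = 0}"
    proof (rule holomorphic_countable_zeros)
      show "deriv f holomorphic_on UNIV" using f(1) by (intro holomorphic_deriv) auto
    qed (use False in auto)
    then show ?thesis by (simp add: Z_def)
  qed
  \<comment> \<open>Near a noncritical point the preimage lies in the image of a part of
    \<open>S\<close> under a smooth local inverse, hence is null; and a set that is locally null is
    null.\<close>
  have "negligible (f -` S - Z)"
  proof (subst locally_negligible_alt, intro ballI)
    fix z assume z: "z \<in> f -` S - Z"
    then have "deriv f z \<noteq> 0" by (simp add: Z_def)
    then obtain N h where N: "open N" "z \<in> N" "open (f ` N)" "h holomorphic_on f ` N"
      and h: "\<And>z. z \<in> N \<Longrightarrow> h (f z) = z"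
      using holomorphic_local_inverse[OF f(1)] by metis
    have "negligible (h ` (S \<inter> f ` N))"
    proof (rule negligible_differentiable_image_negligible)
      show "negligible (S \<inter> f ` N)" using S by (rule negligible_subset) auto
      show "h differentiable_on S \<inter> f ` N"
        using holomorphic_on_imp_differentiable_on[OF N(4)] by (rule differentiable_on_subset) auto
    qed simp
    moreover have "(f -` S - Z) \<inter> N \<subseteq> h ` (S \<inter> f ` N)"
      using h by (force simp: image_iff)
    ultimately have "negligible ((f -` S - Z) \<inter> N)" by (rule negligible_subset)
    then show "\<exists>U. openin (top_of_set (f -` S - Z)) U \<and> z \<in> U \<and> negligible U"
      using z N by (intro exI[of _ "(f -` S - Z) \<inter> N"]) (auto simp: openin_open)
  qed
  then have "negligible ((f -` S - Z) \<union> Z)"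
    using negligible_iff_null_sets countable_imp_null_set_lborel[OF Z] by (intro negligible_Un) (auto intro: null_sets_completionI)
  then show ?thesis by (rule negligible_subset) auto
qed

lemma negligible_vimage_iterate:
  assumes f: "f holomorphic_on UNIV" "\<not> f constant_on UNIV" and S: "negligible S"
  shows "negligible ((f ^^ n) -` S)"
proof (induction n)
  case (Suc n)
  have "(f ^^ Suc n) -` S = f -` ((f ^^ n) -` S)" by (auto simp: funpow_swap1)
  then show ?case using negligible_vimage_holomorphic[OF f Suc] by (simp only:)
qed (use S in simp)

subsection \<open>First entries into the disc\<close>

lemma Eit_ge: "real k \<le> Eit k"
proof (induction k)
  case (Suc k)
  have "real (Suc k) \<le> Eit k + 1" using Suc by simp
  also have "\<dots> \<le> exp (Eit k)" by (metis add.commute exp_ge_add_one_self)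
  finally show ?case by (simp add: Eit_def)
qed (simp add: Eit_def)

lemma Eit_Suc: "Eit (Suc k) = exp (Eit k)"
  by (simp add: Eit_def)

text \<open>The factor 3 closes the induction: \<open>3 * (exp (x^2))^2 \<le> exp (3 * x^2)\<close>,
  since \<open>3 \<le> exp (x^2)\<close> once \<open>x \<ge> 2\<close>.\<close>

lemma Eit_dominates:
  fixes x :: "nat \<Rightarrow> real"
  assumes ge: "\<And>n. 2 \<le> x n" and step: "\<And>n. x (Suc n) \<le> exp ((x n)\<^sup>2)" and base: "3 * (x 0)\<^sup>2 \<le> Eit k"
  shows "3 * (x n)\<^sup>2 \<le> Eit (n + k)"
proof (induction n)
  case (Suc n)
  have "(2::real)\<^sup>2 \<le> (x n)\<^sup>2" using ge[of n] by (intro power_mono) auto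
  then have "3 \<le> exp ((x n)\<^sup>2)" using exp_ge_add_one_self[of "(x n)\<^sup>2"] by (simp del: exp_ge_add_one_self)
  moreover have "(x (Suc n))\<^sup>2 \<le> (exp ((x n)\<^sup>2))\<^sup>2" using step ge[of "Suc n"] by (intro power_mono) auto
  ultimately have "3 * (x (Suc n))\<^sup>2 \<le> exp ((x n)\<^sup>2) * (exp ((x n)\<^sup>2))\<^sup>2" by (intro mult_mono) auto
  also have "\<dots> = exp (3 * (x n)\<^sup>2)" by (simp add: power2_eq_square flip: exp_add)
  also have "\<dots> \<le> exp (Eit (n + k))" using Suc by simp
  finally show ?case by (simp add: Eit_Suc)
qed (use base in simp)

text \<open>A Borel--Cantelli argument: by Vitali's covering lemma each of the disjoint sets \<open>B n\<close> has
  area at least a multiple of \<open>\<eta> n\<close> times the area of \<open>E\<close>.\<close>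

lemma disjoint_sets_near_compact:
  fixes E S :: "complex set" and B :: "nat \<Rightarrow> complex set"
  assumes E: "compact E" and S: "S \<in> lmeasurable"
    and B: "\<And>n. B n \<in> lmeasurable" "\<And>n. B n \<subseteq> S" "pairwise (\<lambda>i j. disjnt (B i) (B j)) UNIV"
    and near: "\<And>n w. n \<ge> 1 \<Longrightarrow> w \<in> E \<Longrightarrow> \<exists>\<rho>>0. \<eta> n * \<rho>\<^sup>2 \<le> measure lebesgue (B n \<inter> ball w \<rho>)"
    and \<eta>: "\<And>n. n \<ge> 1 \<Longrightarrow> 0 \<le> \<eta> n"
  shows "measure lebesgue E * (\<Sum>n=1..m. \<eta> n) \<le> 25 * pi * measure lebesgue S"
proof -
  have each: "measure lebesgue E * \<eta> n \<le> 25 * pi * measure lebesgue (B n)" if n: "n \<ge> 1" for n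
  proof -
    obtain \<rho> where \<rho>: "\<And>w. w \<in> E \<Longrightarrow> \<rho> w > 0 \<and> \<eta> n * (\<rho> w)\<^sup>2 \<le> measure lebesgue (B n \<inter> ball w (\<rho> w))"
      using near[OF n] by metis
    obtain C where C: "finite C" "C \<subseteq> E" "pairwise (\<lambda>x y. disjnt (ball x (\<rho> x)) (ball y (\<rho> y))) C"
      "measure lebesgue E \<le> 25 * pi * (\<Sum>x\<in>C. (\<rho> x)\<^sup>2)"
      using Vitali_compact[OF E, of \<rho>] \<rho> by blast
    have m: "B n \<inter> ball w (\<rho> w) \<in> lmeasurable" for w using B(1) by (intro fmeasurable.Int) auto
    have "\<eta> n * (\<Sum>x\<in>C. (\<rho> x)\<^sup>2) = (\<Sum>x\<in>C. \<eta> n * (\<rho> x)\<^sup>2)" by (rule sum_distrib_left)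
    also have "\<dots> \<le> (\<Sum>x\<in>C. measure lebesgue (B n \<inter> ball x (\<rho> x)))"
      using \<rho> C(2) by (intro sum_mono) blast
    also have "\<dots> = measure lebesgue (\<Union>x\<in>C. B n \<inter> ball x (\<rho> x))"
      using C(1,3) m by (intro measure_UNION'[symmetric]) (auto simp: pairwise_def disjnt_def)
    also have "\<dots> \<le> measure lebesgue (B n)"
      using m B(1) C(1) by (intro measure_mono_fmeasurable sets.finite_UN fmeasurableD) auto
    finally have "25 * pi * (\<eta> n * (\<Sum>x\<in>C. (\<rho> x)\<^sup>2)) \<le> 25 * pi * measure lebesgue (B n)"
      by (intro mult_left_mono) auto
    moreover have "measure lebesgue E * \<eta> n \<le> 25 * pi * (\<Sum>x\<in>C. (\<rho> x)\<^sup>2) * \<eta> n"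
      using C(4) \<eta>[OF n] by (rule mult_right_mono)
    then have "measure lebesgue E * \<eta> n \<le> 25 * pi * (\<eta> n * (\<Sum>x\<in>C. (\<rho> x)\<^sup>2))" by (simp only: mult_ac)
    ultimately show ?thesis by linarith
  qed
  have "measure lebesgue E * (\<Sum>n=1..m. \<eta> n) \<le> (\<Sum>n=1..m. 25 * pi * measure lebesgue (B n))"
    unfolding sum_distrib_left by (intro sum_mono each) auto
  also have "\<dots> = 25 * pi * (\<Sum>n=1..m. measure lebesgue (B n))" by (simp add: sum_distrib_left)
  also have "(\<Sum>n=1..m. measure lebesgue (B n)) = measure lebesgue (\<Union>n\<in>{1..m}. B n)"
    using B(1,3) by (intro measure_UNION'[symmetric]) (auto simp: pairwise_def)
  also have "25 * pi * \<dots> \<le> 25 * pi * measure lebesgue S"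
    using B S by (intro mult_left_mono measure_mono_fmeasurable) (auto intro!: fmeasurableD)
  finally show ?thesis .
qed

definition exit_set :: "(complex \<Rightarrow> complex) \<Rightarrow> real \<Rightarrow> complex set \<Rightarrow> nat \<Rightarrow> complex set" where
  "exit_set f s S n = {y \<in> S. norm ((f ^^ Suc n) (exp y)) < s \<and> (\<forall>j\<le>n. s \<le> norm ((f ^^ j) (exp y)))}"

lemma disjoint_exit_sets: "pairwise (\<lambda>i j. disjnt (exit_set f s S i) (exit_set f s S j)) UNIV"
proof (rule pairwiseI)
  fix i j :: nat assume "i \<noteq> j"
  then consider "Suc i \<le> j" | "Suc j \<le> i" by linarith
  then show "disjnt (exit_set f s S i) (exit_set f s S j)"
    by cases (force simp: exit_set_def disjnt_def not_le[symmetric] simp del: funpow.simps)+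
qed

lemma continuous_on_iterate_exp:
  assumes "continuous_on UNIV (f :: complex \<Rightarrow> complex)"
  shows "continuous_on UNIV (\<lambda>y. (f ^^ j) (exp y))"
proof (induction j)
  case (Suc j)
  then show ?case using continuous_on_compose2[OF assms Suc] by simp
qed (auto intro: continuous_intros)

lemma exit_set_lmeasurable:
  assumes cont: "continuous_on UNIV (f :: complex \<Rightarrow> complex)" and S: "compact S"
  shows "exit_set f s S n \<in> lmeasurable"
proof -
  have c: "continuous_on UNIV (\<lambda>y. norm ((f ^^ j) (exp y)))" for j
    by (intro continuous_on_norm continuous_on_iterate_exp cont)
  have "closed (\<Inter>j\<in>{..n}. {y. s \<le> norm ((f ^^ j) (exp y))})"
    by (intro closed_INT ballI closed_Collect_le c continuous_on_const)
  moreover have "open {y. norm ((f ^^ Suc n) (exp y)) < s}"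
    by (intro open_Collect_less c continuous_on_const)
  moreover have "exit_set f s S n =
      S \<inter> ((\<Inter>j\<in>{..n}. {y. s \<le> norm ((f ^^ j) (exp y))}) \<inter> {y. norm ((f ^^ Suc n) (exp y)) < s})"
    by (auto simp: exit_set_def)
  ultimately have "exit_set f s S n \<in> sets borel"
    using S compact_imp_closed by (metis borel_closed borel_open sets.Int)
  moreover have "bounded (exit_set f s S n)"
    by (rule bounded_subset[OF compact_imp_bounded[OF S]]) (auto simp: exit_set_def)
  ultimately show ?thesis by (intro bounded_set_imp_lmeasurable) auto
qed

context log_coordinates
begin

text \<open>The size \<open>d\<close> of the derivative of the pull-back is unknown but cancels: the
  image of \<open>ball v (x/4)\<close> lies in \<open>ball w \<rho>\<close> with
  \<open>\<rho> = L * d * (x/4)\<close>, while the image of the part that \<open>f o exp\<close>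
  maps into the small disc has area at least \<open>\<delta> * x^2 * (d / L)^2 / 2000\<close>.
  Divided by \<open>\<rho>^2\<close> this is \<open>\<delta> / (125 * L^4)\<close>, with
  \<open>125 = 2000 / 16\<close>.\<close>

lemma exit_area_near_orbit:
  assumes L: "L \<ge> 1" "\<And>F w \<rho> z. F holomorphic_on ball w \<rho> \<Longrightarrow> inj_on F (ball w \<rho>) \<Longrightarrow> z \<in> ball w (\<rho>/2) \<Longrightarrow>
      norm (deriv F z) \<le> L * norm (deriv F w) \<and> norm (deriv F w) \<le> L * norm (deriv F z)"
    and M: "4 * (ln R + 24 * pi) \<le> M" and n: "n \<ge> 1" and orbit: "\<And>j. j \<le> n \<Longrightarrow> exp M \<le> norm ((f ^^ j) (exp w))"
    and v: "(f ^^ n) (exp w) = exp v" and s: "s \<le> R" and w: "ball w (24 * pi) \<subseteq> S" and S: "compact S"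
    and area: "\<delta> * (Re v)\<^sup>2 \<le> measure lebesgue {u \<in> ball v (Re v / 4). norm (f (exp u)) < s}"
  shows "\<exists>\<rho>>0. \<delta> / (125 * L ^ 4) * \<rho>\<^sup>2 \<le> measure lebesgue (exit_set f s S n \<inter> ball w \<rho>)"
proof -
  obtain \<Psi> where \<Psi>: "\<Psi> holomorphic_on ball v (Re v / 2)" "inj_on \<Psi> (ball v (Re v / 2))" "\<Psi> v = w"
      "\<Psi> ` ball v (Re v / 2) \<subseteq> ball w (24 * pi)"
    and it: "\<And>u. u \<in> ball v (Re v / 2) \<Longrightarrow> (f ^^ n) (exp (\<Psi> u)) = exp u"
      "\<And>u j. u \<in> ball v (Re v / 2) \<Longrightarrow> j \<le> n \<Longrightarrow> R \<le> norm ((f ^^ j) (exp (\<Psi> u)))"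
    using iterate_branch[OF M n orbit v] by blast
  define x where "x = Re v"
  define d where "d = norm (deriv \<Psi> v)"
  have "M \<le> x" using orbit[of n] v by (simp add: x_def)
  moreover have "4 * ln R + 96 * pi \<le> M" using M by simp
  ultimately have x: "x > 0" using lnR pi_gt_zero by linarith
  have "v \<in> ball v (Re v / 2)" using x by (simp add: x_def)
  then have d: "d > 0" unfolding d_def
    using holomorphic_injective_imp_regular[OF \<Psi>(1) open_ball \<Psi>(2)] by simp
  have sub: "ball v (x/4) \<subseteq> ball v (Re v / 2)" using x by (intro subset_ball) (simp add: x_def)
  have D: "norm (deriv \<Psi> u) \<le> L * d" "d / L \<le> norm (deriv \<Psi> u)" if "u \<in> ball v (x/4)" for u
    using L(2)[OF \<Psi>(1,2), of u] that L(1) by (auto simp: d_def x_def field_simps)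
  define \<rho> where "\<rho> = L * d * (x/4)"
  have \<rho>: "\<rho> > 0" using L d x by (simp add: \<rho>_def)
  have img: "\<Psi> u \<in> ball w \<rho>" if u: "u \<in> ball v (x/4)" for u
  proof -
    have "norm (\<Psi> u - \<Psi> v) \<le> (L * d) * norm (u - v)"
    proof (rule field_differentiable_bound[of "ball v (x/4)" \<Psi> "deriv \<Psi>"])
      show "(\<Psi> has_field_derivative deriv \<Psi> z) (at z within ball v (x/4))" if "z \<in> ball v (x/4)" for z
        using holomorphic_derivI[OF \<Psi>(1) open_ball] that sub by blast
    qed (use D u x in auto)
    also have "\<dots> < (L * d) * (x/4)"
      using u L d by (intro mult_strict_left_mono) (auto simp: dist_norm norm_minus_commute)
    finally show ?thesis using \<Psi>(3) by (simp add: dist_norm norm_minus_commute \<rho>_def)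
  qed
  define Y where "Y = {u \<in> ball v (x/4). norm (f (exp u)) < s}"
  have cont: "continuous_on UNIV f" by (rule holomorphic_on_imp_continuous_on[OF holf])
  have "open (ball v (x/4) \<inter> {u. norm (f (exp u)) < s})"
    by (intro open_Int open_ball open_Collect_less continuous_intros continuous_on_compose2[OF cont]) auto
  moreover have "ball v (x/4) \<inter> {u. norm (f (exp u)) < s} = Y" by (auto simp: Y_def)
  ultimately have openY: "open Y" by simp
  have Yball: "Y \<subseteq> ball v (x/4)" by (auto simp: Y_def)
  have Z: "\<Psi> ` Y \<subseteq> exit_set f s S n \<inter> ball w \<rho>"
  proof
    fix y assume "y \<in> \<Psi> ` Y"
    then obtain u where u: "u \<in> Y" "y = \<Psi> u" by blast
    then have ub: "u \<in> ball v (x/4)" "u \<in> ball v (Re v / 2)" using Yball sub by blast+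
    have "y \<in> S" using \<Psi>(4) w u ub by blast
    moreover have "norm ((f ^^ Suc n) (exp y)) < s" using it(1)[OF ub(2)] u by (simp add: Y_def)
    moreover have "\<forall>j\<le>n. s \<le> norm ((f ^^ j) (exp y))" using it(2)[OF ub(2)] s u by (auto intro: order_trans)
    ultimately show "y \<in> exit_set f s S n \<inter> ball w \<rho>" using img[OF ub(1)] u by (simp add: exit_set_def)
  qed
  have "measure lebesgue Y * (d / L)\<^sup>2 \<le> 2000 * measure lebesgue (\<Psi> ` Y)"
  proof (rule injective_image_area)
    show "\<Psi> holomorphic_on Y" "inj_on \<Psi> Y" using \<Psi> Yball sub by (meson holomorphic_on_subset inj_on_subset order_trans)+
    show "bounded Y" using Yball bounded_ball bounded_subset by blast
    show "bounded (\<Psi> ` Y)" using Z bounded_ball bounded_subset by (meson le_infE)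
  qed (use openY D Yball d L in auto)
  also have "\<dots> \<le> 2000 * measure lebesgue (exit_set f s S n \<inter> ball w \<rho>)"
  proof (intro mult_left_mono measure_mono_fmeasurable Z)
    have "open (\<Psi> ` Y)" using open_mapping_thm3[of \<Psi> Y] \<Psi> Yball sub openY
      by (meson holomorphic_on_subset inj_on_subset order_trans)
    then show "\<Psi> ` Y \<in> sets lebesgue" by auto
    show "exit_set f s S n \<inter> ball w \<rho> \<in> lmeasurable"
      by (intro fmeasurable.Int exit_set_lmeasurable cont S) auto
  qed simp
  finally have "measure lebesgue Y * (d / L)\<^sup>2 \<le> 2000 * measure lebesgue (exit_set f s S n \<inter> ball w \<rho>)" .
  moreover have "\<delta> * x\<^sup>2 * (d / L)\<^sup>2 \<le> measure lebesgue Y * (d / L)\<^sup>2"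
    using area by (intro mult_right_mono) (auto simp: Y_def x_def)
  moreover have "\<delta> * x\<^sup>2 * (d / L)\<^sup>2 = 2000 * (\<delta> / (125 * L ^ 4) * \<rho>\<^sup>2)"
    using L(1) by (simp add: \<rho>_def field_simps power2_eq_square power4_eq_xxxx)
  ultimately show ?thesis using \<rho> by (intro exI[of _ \<rho>]) linarith
qed

end

section \<open>Growth along orbits and the conclusion from divergence\<close>

lemma orbit_growth:
  fixes f :: "complex \<Rightarrow> complex" and M :: real
  assumes cont: "continuous_on UNIV f" and M: "2 \<le> M"
    and growth: "ln (ln (max_modulus f (exp x))) \<le> A (exp x) * x"
    and A: "A (exp x) < x"
    and z: "norm z = exp x" "M \<le> x" "exp M \<le> norm (f z)"
  shows "ln (norm (f z)) \<le> exp (x\<^sup>2)" "0 < A (exp x)"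
proof -
  have "compact (norm ` f ` sphere 0 (exp x))"
    by (intro compact_continuous_image continuous_on_norm continuous_on_id continuous_on_subset[OF cont]) auto
  then have "bdd_above (norm ` f ` sphere 0 (exp x))"
    by (intro bounded_imp_bdd_above compact_imp_bounded)
  then have "norm (f z) \<le> max_modulus f (exp x)"
    unfolding max_modulus_def using z by (intro cSUP_upper) (auto simp: image_image)
  moreover have pos: "0 < norm (f z)" using z(3) exp_gt_zero[of M] by linarith
  moreover have ge: "2 \<le> ln (norm (f z))" using z(3) pos M by (metis ln_exp ln_le_cancel_iff exp_gt_zero order_trans)
  ultimately have "ln (norm (f z)) \<le> ln (max_modulus f (exp x))" by (subst ln_le_cancel_iff) linarith+
  then have "ln (ln (norm (f z))) \<le> ln (ln (max_modulus f (exp x)))" using ge by simp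
  then have le: "ln (ln (norm (f z))) \<le> A (exp x) * x" using growth by linarith
  \<comment> \<open>As the image point is large too, the growth condition forces \<open>A\<close> to
    be positive; this matters because \<open>1 / A\<close> serves as a density.\<close>
  moreover have "0 < ln (ln (norm (f z)))" using ge by (simp add: ln_gt_zero)
  ultimately have "0 < A (exp x) * x" by linarith
  then show "0 < A (exp x)" using M z(2) by (simp add: zero_less_mult_iff)
  have "A (exp x) * x \<le> x * x" using A M z(2) by (intro mult_right_mono) auto
  then have "ln (ln (norm (f z))) \<le> x\<^sup>2" using le by (simp add: power2_eq_square)
  then show "ln (norm (f z)) \<le> exp (x\<^sup>2)" using ge by (metis exp_le_cancel_iff exp_ln less_le_trans zero_less_numeral)
qed

theorem theorem1p5:
  fixes f :: "complex \<Rightarrow> complex" and r0 r' c :: real and A :: "real \<Rightarrow> real"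
  assumes fB: "class_B f"
    and r0: "r0 > 0" and sing: "singular_values f \<subseteq> ball 0 r0"
    and r': "r' > 0"
    and Acont: "continuous_on {r'..} A"
    and Amono: "mono_on {r'..} A"
    and Alog: "eventually (\<lambda>r. A r < ln r) at_top"
    and Adiv: "filterlim (\<lambda>n. \<Sum>k=1..n. 1 / A (Eit k)) at_top sequentially"
    and c: "63/65 \<le> c" "c < 1"
    and growth: "\<And>r. r \<ge> r' \<Longrightarrow> ln (ln (max_modulus f r)) \<le> A r * ln r"
    and thetacond: "\<And>r. r \<ge> r' \<Longrightarrow>
        (1 / ln r) * interval_lebesgue_integral lborel (ereal (r powr c)) (ereal r) (\<lambda>t. theta f r0 t / t)
          \<ge> 1 / A r"
  shows "escaping_set f \<in> null_sets lebesgue"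
proof -
  have holf: "f holomorphic_on UNIV" and npoly: "\<not> (\<exists>p. \<forall>z. f z = poly p z)"
    using fB by (auto simp: class_B_def transcendental_entire_def)
  have cont: "continuous_on UNIV f" by (rule holomorphic_on_imp_continuous_on[OF holf])
  have nconst: "\<not> f constant_on UNIV"
  proof
    assume "f constant_on UNIV"
    then obtain a where "\<And>z. f z = a" by (auto simp: constant_on_def)
    then have "\<forall>z. f z = poly [:a:] z" by simp
    then show False using npoly by blast
  qed
  \<comment> \<open>\<open>R\<close> may exceed \<open>r0\<close>: univalence is used over the
    exterior of the larger disc, while \<open>theta\<close> and the exit sets refer to
    \<open>r0\<close>.\<close>
  define R where "R = max (max 1 r0) (norm (f 0) + 1)"
  have R: "r0 \<le> R" "1 \<le> R" "norm (f 0) < R" by (auto simp: R_def)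
  have sing_less: "norm a < r0" if "a \<in> critical_values f \<union> asymptotic_values f" for a
    using that sing closure_subset by (fastforce simp: singular_values_def)
  interpret log_coordinates f R
  proof
    show "deriv f z \<noteq> 0" if "R < norm (f z)" for z
      using sing_less[of "f z"] that R by (auto simp: critical_values_def)
    show "norm a \<le> R" if "continuous_on {0..} \<gamma>" "filterlim \<gamma> at_infinity at_top"
        "((\<lambda>t::real. f (\<gamma> t)) \<longlongrightarrow> a) at_top" for \<gamma> a
    proof -
      have "a \<in> asymptotic_values f" using that by (auto simp: asymptotic_values_def)
      then show ?thesis using sing_less[of a] R by simp
    qed
  qed (use holf npoly R in auto)
  obtain L where L: "L \<ge> 1" "\<And>F w \<rho> z. F holomorphic_on ball w \<rho> \<Longrightarrow> inj_on F (ball w \<rho>) \<Longrightarrow> z \<in> ball w (\<rho>/2) \<Longrightarrow>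
      norm (deriv F z) \<le> L * norm (deriv F w) \<and> norm (deriv F w) \<le> L * norm (deriv F z)"
    using univalent_distortion by metis
  obtain r1 where r1: "\<And>r. r \<ge> r1 \<Longrightarrow> A r < ln r"
    using Alog by (auto simp: eventually_at_top_linorder)
  \<comment> \<open>In this order: room for the branches, enough periods in the disc about
    \<open>v\<close>, the growth estimates, and validity of the hypotheses on \<open>A\<close> from
    \<open>exp M\<close> on; \<open>max r1 1\<close> keeps the logarithm meaningful.\<close>
  define M where "M = Max {4 * (ln R + 24 * pi), 32 * pi, 2, ln r', ln (max r1 1)}"
  have M: "4 * (ln R + 24 * pi) \<le> M" "32 * pi \<le> M" "2 \<le> M" "ln r' \<le> M" "ln (max r1 1) \<le> M"
    unfolding M_def by (rule Max_ge; simp)+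
  have Mr': "r' \<le> exp x" "r1 \<le> exp x" if "M \<le> x" for x
  proof -
    have "exp (ln r') \<le> exp x" "exp (ln (max r1 1)) \<le> exp x"
      using M(4,5) that by (subst exp_le_cancel_iff; linarith)+
    moreover have "exp (ln r') = r'" "exp (ln (max r1 1)) = max r1 1" using r' by (intro exp_ln; simp)+
    ultimately show "r' \<le> exp x" "r1 \<le> exp x" by linarith+
  qed
  define J where "J = {w. \<forall>n. exp M \<le> norm ((f ^^ n) (exp w))}"
  have closedJ: "closed J"
  proof -
    have "closed (\<Inter>n\<in>UNIV. {w. exp M \<le> norm ((f ^^ n) (exp w))})"
      by (intro closed_INT ballI closed_Collect_le continuous_on_const continuous_on_norm continuous_on_iterate_exp cont)
    moreover have "(\<Inter>n\<in>UNIV. {w. exp M \<le> norm ((f ^^ n) (exp w))}) = J" by (auto simp: J_def)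
    ultimately show ?thesis by simp
  qed
  have "negligible (J \<inter> cball 0 B)" for B
  proof -
    define E where "E = J \<inter> cball 0 B"
    have E: "compact E" unfolding E_def using closedJ by (intro closed_Int_compact) auto
    have "measure lebesgue E = 0"
    proof (rule ccontr)
      assume "measure lebesgue E \<noteq> 0"
      then have Epos: "measure lebesgue E > 0" by (simp add: zero_less_measure_iff)
      obtain k :: nat where k: "3 * B\<^sup>2 \<le> real k" using real_arch_simple by blast
      \<comment> \<open>The bound \<open>B\<close> on the starting points alone determines
        \<open>k\<close>. The additional 1 pays for an exponential: \<open>A\<close> is evaluated at
        \<open>exp (9 * x w n / 8)\<close>, and the exponent is at most
        \<open>Eit (n + k)\<close>.\<close>
      define \<alpha> where "\<alpha> n = A (Eit (n + (k + 1)))" for n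
      define x where "x w n = ln (norm ((f ^^ n) (exp w)))" for w n
      have nz: "(f ^^ n) (exp w) \<noteq> 0" if "w \<in> E" for w n
        using that by (auto simp: E_def J_def) (metis exp_gt_zero norm_zero not_le)
      have ex: "norm ((f ^^ n) (exp w)) = exp (x w n)" if "w \<in> E" for w n
        using nz[OF that] by (simp add: x_def)
      have xM: "M \<le> x w n" if "w \<in> E" for w n
        using that ex[OF that, of n] by (simp add: E_def J_def) (metis exp_le_cancel_iff)
      have g: "x w (Suc n) \<le> exp ((x w n)\<^sup>2)" "0 < A (exp (x w n))" if w: "w \<in> E" for w n
      proof -
        have gr: "ln (ln (max_modulus f (exp (x w n)))) \<le> A (exp (x w n)) * x w n"
          using growth[OF Mr'(1)[OF xM[OF w]]] by simp
        have lt: "A (exp (x w n)) < x w n" using r1[OF Mr'(2)[OF xM[OF w]]] by simp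
        have "exp M \<le> norm (f ((f ^^ n) (exp w)))" using w by (auto simp: E_def J_def dest: spec[of _ "Suc n"])
        from orbit_growth[where A = A, OF cont M(3) gr lt ex[OF w] xM[OF w] this]
        show "x w (Suc n) \<le> exp ((x w n)\<^sup>2)" "0 < A (exp (x w n))" by (simp_all add: x_def)
      qed
      have xE: "3 * (x w n)\<^sup>2 \<le> Eit (n + k)" if w: "w \<in> E" for w n
      proof (rule Eit_dominates)
        show "2 \<le> x w n" for n using xM[OF w, of n] M(3) by simp
        have "x w 0 = Re w" by (simp add: x_def)
        also have "\<dots> \<le> B" using w complex_Re_le_cmod[of w] by (simp add: E_def)
        finally have "(x w 0)\<^sup>2 \<le> B\<^sup>2" using xM[OF w, of 0] M(3) by (intro power_mono) auto
        then show "3 * (x w 0)\<^sup>2 \<le> Eit k" using k Eit_ge[of k] by linarith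
      qed (use g[OF w] in auto)
      have A98: "0 < A (exp (9 * x w n / 8))" "A (exp (9 * x w n / 8)) \<le> \<alpha> n" if w: "w \<in> E" for w n
      proof -
        have x2: "2 \<le> x w n" using xM[OF w, of n] M(3) by simp
        have "2 * x w n \<le> (x w n)\<^sup>2" using x2 by (simp add: power2_eq_square)
        then have "9 * x w n / 8 \<le> 3 * (x w n)\<^sup>2" using x2 by linarith
        then have "9 * x w n / 8 \<le> Eit (n + k)" using xE[OF w, of n] by linarith
        then have le: "exp (9 * x w n / 8) \<le> Eit (n + (k + 1))" by (simp add: Eit_Suc)
        have ge: "exp (x w n) \<le> exp (9 * x w n / 8)" using x2 by simp
        have r'le: "r' \<le> exp (x w n)" by (rule Mr'(1)[OF xM[OF w]])
        have r'le2: "r' \<le> exp (9 * x w n / 8)" using r'le ge by (rule order_trans)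
        have "A (exp (x w n)) \<le> A (exp (9 * x w n / 8))"
          by (rule mono_onD[OF Amono _ _ ge]) (use r'le r'le2 in simp_all)
        then show "0 < A (exp (9 * x w n / 8))" using g(2)[OF w, of n] by linarith
        show "A (exp (9 * x w n / 8)) \<le> \<alpha> n" unfolding \<alpha>_def
          by (rule mono_onD[OF Amono _ _ le]) (use r'le2 order_trans[OF r'le2 le] in simp_all)
      qed
      \<comment> \<open>A set of positive measure has a point, and its orbit certifies that every
        \<open>\<alpha> n\<close> is positive.\<close>
      obtain w0 where w0: "w0 \<in> E" using Epos by (metis all_not_in_conv less_irrefl measure_empty)
      have \<alpha>: "\<alpha> n > 0" for n using A98[OF w0, of n] by linarith
      define S where "S = cball (0::complex) (B + 24 * pi)"
      \<comment> \<open>\<open>16 * pi\<close> comes from the area of the preimage of the disc,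
        \<open>125 * L ^ 4\<close> from pulling it back.\<close>
      define C where "C = 16 * pi * 125 * L ^ 4"
      have C: "C > 0" using L(1) by (simp add: C_def)
      have bound: "measure lebesgue E * (\<Sum>n=1..m. 1 / (C * \<alpha> n)) \<le> 25 * pi * measure lebesgue S" for m
      proof (rule disjoint_sets_near_compact[OF E, where B = "exit_set f r0 S"])
        show "exit_set f r0 S n \<in> lmeasurable" for n
          by (rule exit_set_lmeasurable[OF cont]) (simp add: S_def)
        fix n :: nat and w assume n: "n \<ge> 1" and w: "w \<in> E"
        define v where "v = Ln ((f ^^ n) (exp w))"
        have v: "(f ^^ n) (exp w) = exp v" using nz[OF w] by (simp add: v_def)
        have Rev: "Re v = x w n" using nz[OF w] by (simp add: v_def x_def)
        have "ball w (24 * pi) \<subseteq> S"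
        proof
          fix y assume "y \<in> ball w (24 * pi)"
          moreover have "norm w \<le> B" using w by (simp add: E_def)
          ultimately show "y \<in> S" using norm_triangle_ineq2[of y w] by (simp add: S_def dist_norm norm_minus_commute)
        qed
        moreover have "1 / (16 * pi * \<alpha> n) * (Re v)\<^sup>2 \<le> measure lebesgue {u \<in> ball v (Re v / 4). norm (f (exp u)) < r0}"
        proof -
          let ?r = "exp (9 * x w n / 8)"
          have "(x w n)\<^sup>2 / (16 * pi * \<alpha> n) \<le> (x w n)\<^sup>2 / (16 * pi * A ?r)"
            using A98[OF w, of n] by (intro divide_left_mono mult_left_mono mult_pos_pos) auto
          also have "\<dots> \<le> measure lebesgue {u \<in> ball v (x w n / 4). norm (f (exp u)) < r0}"
          proof (rule area_ge_theta_integral[OF cont c Rev _ A98(1)[OF w] thetacond refl])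
            show "32 * pi \<le> x w n" using M(2) xM[OF w, of n] by linarith
            have "x w n \<le> 9 * x w n / 8" using xM[OF w, of n] M(3) by linarith
            then show "r' \<le> ?r" using Mr'(1) xM[OF w, of n] by (meson order_trans)
          qed
          finally show ?thesis by (simp add: Rev)
        qed
        ultimately have "\<exists>\<rho>>0. 1 / (16 * pi * \<alpha> n) / (125 * L ^ 4) * \<rho>\<^sup>2 \<le> measure lebesgue (exit_set f r0 S n \<inter> ball w \<rho>)"
          using w by (intro exit_area_near_orbit[OF L M(1) n _ v R(1)]) (auto simp: E_def J_def S_def)
        then show "\<exists>\<rho>>0. 1 / (C * \<alpha> n) * \<rho>\<^sup>2 \<le> measure lebesgue (exit_set f r0 S n \<inter> ball w \<rho>)"
          by (simp add: C_def mult_ac)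
      next
        show "S \<in> lmeasurable" by (simp add: S_def)
        show "0 \<le> 1 / (C * \<alpha> n)" for n using \<alpha>[of n] C by simp
              show "exit_set f r0 S n \<subseteq> S" for n by (auto simp: exit_set_def)
      qed (rule disjoint_exit_sets)
      \<comment> \<open>The head of the series removed by the shift, plus the bound for the shifted
        sum, plus 1 for a strict contradiction.\<close>
      define T where "T = (\<Sum>j=1..k+1. 1 / A (Eit j)) + 25 * pi * measure lebesgue S * C / measure lebesgue E + 1"
      obtain m where m: "\<And>n. n \<ge> m \<Longrightarrow> T \<le> (\<Sum>j=1..n. 1 / A (Eit j))"
        using Adiv unfolding filterlim_at_top eventually_sequentially by blast
      have "(\<Sum>j=1..(k+1)+m. 1 / A (Eit j)) = (\<Sum>j=1..k+1. 1 / A (Eit j)) + (\<Sum>j=(k+1)+1..(k+1)+m. 1 / A (Eit j))"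
        by (rule sum.ub_add_nat) simp
      also have "(\<Sum>j=(k+1)+1..(k+1)+m. 1 / A (Eit j)) = (\<Sum>n=1..m. 1 / \<alpha> n)"
        unfolding \<alpha>_def using sum.shift_bounds_cl_nat_ivl[of "\<lambda>j. 1 / A (Eit j)" 1 "k+1" m] by (simp add: add_ac)
      finally have "25 * pi * measure lebesgue S * C / measure lebesgue E + 1 \<le> (\<Sum>n=1..m. 1 / \<alpha> n)"
        using m[of "(k+1)+m"] by (simp add: T_def)
      moreover have eq: "(\<Sum>n=1..m. 1 / (C * \<alpha> n)) = (\<Sum>n=1..m. 1 / \<alpha> n) / C"
        by (simp add: sum_divide_distrib mult_ac)
      have "(\<Sum>n=1..m. 1 / \<alpha> n) \<le> 25 * pi * measure lebesgue S * C / measure lebesgue E"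
        using bound[of m, unfolded eq] C Epos by (simp add: field_simps)
      with calculation(1) show False by linarith
    qed
    then show ?thesis using E by (simp add: negligible_iff_measure lmeasurable_compact E_def)
  qed
  then have "negligible (\<Union>n. J \<inter> cball 0 (real n))" by (intro negligible_Union_nat)
  moreover have "J = (\<Union>n. J \<inter> cball 0 (real n))"
    using real_arch_simple by auto
  ultimately have "negligible J" by simp
  then have "negligible (exp ` J)"
    by (rule negligible_differentiable_image_negligible[rotated])
      (auto intro!: holomorphic_on_imp_differentiable_on holomorphic_intros)
  then have "negligible (\<Union>N. (f ^^ N) -` (exp ` J))"
    by (intro negligible_Union_nat negligible_vimage_iterate[OF holf nconst])
  \<comment> \<open>An escaping orbit eventually stays at moduli of at least \<open>exp M\<close>,
    so a logarithm of some iterate lies in \<open>J\<close>.\<close>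
  moreover have "escaping_set f \<subseteq> (\<Union>N. (f ^^ N) -` (exp ` J))"
  proof
    fix z assume "z \<in> escaping_set f"
    then have "\<forall>\<^sub>F n in sequentially. exp M \<le> norm ((f ^^ n) z)"
      using filterlim_at_infinity[of 0 "\<lambda>n. (f ^^ n) z" sequentially] by (simp add: escaping_set_def)
    then obtain N where N: "\<And>n. n \<ge> N \<Longrightarrow> exp M \<le> norm ((f ^^ n) z)" by (auto simp: eventually_sequentially)
    have nz: "(f ^^ N) z \<noteq> 0" using N[of N] by (metis exp_gt_zero norm_zero not_le order_refl)
    have "Ln ((f ^^ N) z) \<in> J"
      using N nz by (simp add: J_def flip: funpow_add[THEN fun_cong, unfolded o_def])
    then have "(f ^^ N) z \<in> exp ` J" using nz by (intro image_eqI[of _ _ "Ln ((f ^^ N) z)"]) auto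
    then show "z \<in> (\<Union>N. (f ^^ N) -` (exp ` J))" by blast
  qed
  ultimately have "negligible (escaping_set f)" by (rule negligible_subset)
  then show ?thesis by (simp add: negligible_iff_null_sets)
qed

end
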